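(* As $x\to\infty$, $$\frac{285}{416}\cdot \frac{1}{\zeta(2)}\,x \log x+O(x \log\log x)\le\sum_{n\le x} \phi\left(\left[\frac{x}{n}\right]\right)\le \left(\frac{285}{416}\cdot \frac{1}{\zeta(2)}+\frac{131}{416}\right)x \log x+O(x \log\log x),$$ where the sum runs over positive integers $n\le x$.
   Context: $\phi$ denotes the Euler totient function, $\zeta$ the Riemann zeta function, and $[y]$ the integral part (floor) of a real number $y$. *)

theory Defs
  imports
    "HOL-Analysis.Analysis"
    "HOL-Library.Landau_Symbols"
    "HOL-Number_Theory.Totient"
begin

text \<open>
  The Riemann zeta function on the half-line \<open>s > 1\<close>, by its Dirichlet series.
  For \<open>s \<le> 1\<close> the series diverges and the value carries no meaning.
\<close>

definition zeta :: "real \<Rightarrow> real" where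
  "zeta s = (\<Sum>n. 1 / real (Suc n) powr s)"

end

theory Submission
  imports Defs "HOL-Real_Asymp.Real_Asymp"
begin

text \<open>
  Up to \<open>O(x)\<close> the sum equals \<open>x \<Sum>\<^bsub>n \<le> x\<^esub> F([x/n]) / n\<close> with \<open>F(m) = \<phi>(m) / m\<close>.  If \<open>[x/n]\<close> is
  equidistributed modulo every fixed \<open>q\<close> for \<open>n\<close> in a set \<open>R\<close> (with weights \<open>1 / n\<close>), then \<open>F([x/n])\<close>
  has mean value \<open>1 / \<zeta>(2)\<close> on \<open>R\<close>, and outside \<open>R\<close> one only uses \<open>0 \<le> F \<le> 1\<close>.  Both bounds
  therefore hold, even without error terms, as soon as \<open>R\<close> has logarithmic density larger than
  \<open>285 / 416\<close> in \<open>[1, x]\<close>.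

  Divisibility \<open>q | [x/n]\<close> means that the fractional part of \<open>x / (q n)\<close> is less than \<open>1 / q\<close>, so
  equidistribution reduces to cancellation in \<open>\<Sum> e(y / n) / n\<close> for \<open>y\<close> close to \<open>x\<close>.  After \<open>k\<close>
  applications of van der Corput's inequality the increments of the phase have size about
  \<open>y / n\<^bsup>k+2\<^esup>\<close>, and the Kusmin--Landau inequality gives a saving when
  \<open>n\<close> lies between \<open>x\<^bsup>1/(k+2)\<^esup>\<close> and \<open>x\<^bsup>1/(k+1)\<^esup>\<close>.  The values \<open>k = 0, 1, 2\<close> give almost all
  of \<open>[x\<^bsup>1/4\<^esup>, x]\<close>, a density of almost \<open>3 / 4\<close>.
\<close>

section \<open>Exponential sums\<close>

definition ee :: "real \<Rightarrow> complex" where "ee t = cis (2 * pi * t)"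

lemma norm_ee [simp]: "norm (ee t) = 1"
  by (simp add: ee_def)

lemma ee_0 [simp]: "ee 0 = 1"
  by (simp add: ee_def)

lemma ee_add: "ee (s + t) = ee s * ee t"
  by (simp add: ee_def cis_mult algebra_simps)

lemma ee_minus: "ee (- t) = cnj (ee t)"
  by (simp add: ee_def cis_cnj)

lemma ee_diff: "ee (s - t) = ee s * cnj (ee t)"
  by (metis ee_add ee_minus add_uminus_conv_diff)

lemma ee_power: "ee t ^ n = ee (real n * t)"
  by (simp add: ee_def Complex.DeMoivre algebra_simps)

lemma ee_int [simp]: "ee (of_int k) = 1"
  by (simp add: ee_def cis_multiple_2pi)

section \<open>The Kusmin--Landau inequality\<close>

lemma norm_one_minus_ee: "norm (1 - ee t) = 2 * \<bar>sin (pi * t)\<bar>"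
proof -
  have "(norm (1 - ee t))\<^sup>2 = (1 - cos (2 * (pi * t)))\<^sup>2 + (sin (2 * (pi * t)))\<^sup>2"
    by (simp add: ee_def cmod_def mult.assoc)
  also have "\<dots> = 2 - 2 * cos (2 * (pi * t))"
    using sin_cos_squared_add [of "2 * (pi * t)"] by (simp add: power2_eq_square algebra_simps)
  also have "\<dots> = (2 * \<bar>sin (pi * t)\<bar>)\<^sup>2"
    by (simp add: cos_double_sin power2_eq_square)
  finally show ?thesis
    by (rule power2_eq_imp_eq) auto
qed

text \<open>Sine is concave on [0, pi], so it lies above its chord from 0 to pi/2 (Jordan's
  inequality).\<close>

lemma sin_pi_ge:
  assumes "0 \<le> t" "t \<le> 1 / 2"
  shows "2 * t \<le> sin (pi * t)"
proof -
  have "concave_on {0..pi} sin"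
    by (rule f''_le0_imp_concave[where f' = cos and f'' = "\<lambda>x. - sin x"])
       (auto intro!: derivative_eq_intros simp: sin_ge_zero)
  then have "convex_on {0..pi} (\<lambda>x. - sin x)"
    by (simp add: concave_on_def)
  from convex_onD [OF this, of "2 * t" 0 "pi / 2"] assms show ?thesis
    by (simp add: mult.commute)
qed

text \<open>The real part is constant, so these coefficients vary only through the cotangent. This
  makes their total variation computable in the Kusmin--Landau argument.\<close>

lemma inverse_one_minus_ee:
  assumes "0 < d" "d < 1"
  shows "1 / (1 - ee (- d)) = Complex (1 / 2) (- cot (pi * d) / 2)"
proof -
  have s: "sin (pi * d) > 0"
    using assms by (intro sin_gt_zero) auto
  have e: "1 - ee (- d) = Complex (2 * (sin (pi * d))\<^sup>2) (2 * sin (pi * d) * cos (pi * d))"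
    by (simp add: ee_def complex_eq_iff sin_double cos_double_sin mult.assoc del: cis_cnj)
  have nz: "1 - ee (- d) \<noteq> 0"
    using s by (auto simp: e complex_eq_iff)
  have "Complex (1 / 2) (- cot (pi * d) / 2) * (1 - ee (- d)) = 1"
    using s sin_cos_squared_add [of "pi * d"]
    by (auto simp: e complex_eq_iff cot_def field_simps power2_eq_square)
  with nz show ?thesis
    by (simp add: field_simps)
qed

text \<open>cot(pi s) - cot(pi t) = sin(pi t - pi s) / (sin(pi s) sin(pi t)), where no sine is
  negative.\<close>

lemma cot_pi_antimono:
  assumes "0 < s" "s \<le> t" "t < 1"
  shows "cot (pi * t) \<le> cot (pi * s)"
proof -
  have "sin (pi * s) > 0" "sin (pi * t) > 0"
    using assms by (auto intro!: sin_gt_zero)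
  moreover have "sin (pi * t - pi * s) \<ge> 0"
  proof (rule sin_ge_zero)
    have "pi * t - pi * s = pi * (t - s)" by (simp add: algebra_simps)
    then show "pi * t - pi * s \<le> pi" using assms
      by (metis add_increasing2 diff_le_eq less_eq_real_def mult_left_le pi_ge_zero)
  qed (use assms in auto)
  ultimately show ?thesis
    by (simp add: cot_def sin_diff field_simps)
qed

text \<open>With \<open>d n\<close> the decrement of \<open>g\<close>, each term equals (e(g(n)) -
  e(g(n+1))) / (1 - e(-d(n))). Jordan's inequality bounds the coefficients \<open>c n\<close>, and
  their monotone imaginary parts bound the cost of summing by parts.\<close>

lemma Kusmin_Landau:
  fixes g :: "nat \<Rightarrow> real"
  assumes th: "\<theta> > 0"
    and lo: "\<And>n. a \<le> n \<Longrightarrow> n < b \<Longrightarrow> \<theta> \<le> g n - g (Suc n)"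
    and hi: "\<And>n. a \<le> n \<Longrightarrow> n < b \<Longrightarrow> g n - g (Suc n) \<le> 1 / 2"
    and dec: "\<And>n. a \<le> n \<Longrightarrow> Suc n < b \<Longrightarrow> g (Suc n) - g (Suc (Suc n)) \<le> g n - g (Suc n)"
  shows "norm (\<Sum>n = a..<b. ee (g n)) \<le> 1 / \<theta>"
proof (cases "a < b")
  case True
  define d where "d n = g n - g (Suc n)" for n
  define c where "c n = Complex (1 / 2) (- cot (pi * d n) / 2)" for n
  have d: "0 < d n" "d n \<le> 1 / 2" "\<theta> \<le> d n" if "a \<le> n" "n < b" for n
    using lo [of n] hi [of n] that th by (auto simp: d_def)
  have cc: "c n = 1 / (1 - ee (- d n))" if "a \<le> n" "n < b" for n
    using d [OF that] by (simp add: c_def inverse_one_minus_ee)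
  have cb: "norm (c n) \<le> 1 / (4 * \<theta>)" if "a \<le> n" "n < b" for n
  proof -
    have "4 * \<theta> \<le> 2 * \<bar>sin (pi * (- d n))\<bar>"
      using d [OF that] sin_pi_ge [of "d n"] by auto
    then have "4 * \<theta> \<le> norm (1 - ee (- d n))"
      by (simp only: norm_one_minus_ee)
    then show ?thesis
      using th by (simp add: cc [OF that] norm_divide frac_le)
  qed
  have z: "ee (g n) = (ee (g n) - ee (g (Suc n))) * c n" if "a \<le> n" "n < b" for n
  proof -
    have "1 - ee (- d n) \<noteq> 0"
      using d [OF that] sin_pi_ge [of "d n"] norm_one_minus_ee [of "- d n"] by auto
    moreover have "ee (g (Suc n)) = ee (g n) * ee (- d n)"
      by (simp add: d_def flip: ee_add)
    ultimately show ?thesis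
      by (simp add: cc [OF that] field_simps)
  qed
  \<comment> \<open>Summation by parts: the total variation of \<open>c\<close> telescopes because the cotangent is monotone.\<close>
  have main: "norm ((\<Sum>n = a..<m. (ee (g n) - ee (g (Suc n))) * c n) + ee (g m) * c (m - 1))
      \<le> 1 / (4 * \<theta>) + (cot (pi * d (m - 1)) - cot (pi * d a)) / 2"
    if "a < m" "m \<le> b" for m
    using that
  proof (induction m)
    case (Suc m)
    show ?case
    proof (cases "a = m")
      case True
      with Suc.prems cb [of m] show ?thesis by (simp add: algebra_simps norm_mult)
    next
      case False
      with Suc.prems have m: "a < m" "m < b" "m \<le> b" by auto
      then have m1: "a \<le> m - 1" "m - 1 < b" "Suc (m - 1) = m" by auto
      have cot: "cot (pi * d (m - 1)) \<le> cot (pi * d m)"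
        using m m1 d [of m] d [OF m1(1,2)] dec [OF m1(1)]
        by (intro cot_pi_antimono) (auto simp: d_def)
      have "c m - c (m - 1) = Complex 0 (- (cot (pi * d m) - cot (pi * d (m - 1))) / 2)"
        by (simp add: c_def complex_eq_iff field_simps)
      then have "norm (c m - c (m - 1)) = (cot (pi * d m) - cot (pi * d (m - 1))) / 2"
        using cot by (simp add: complex_norm)
      then have n2: "norm (ee (g m) * (c m - c (m - 1))) = (cot (pi * d m) - cot (pi * d (m - 1))) / 2"
        by (simp add: norm_mult)
      have "(\<Sum>n = a..<Suc m. (ee (g n) - ee (g (Suc n))) * c n) + ee (g (Suc m)) * c m =
         ((\<Sum>n = a..<m. (ee (g n) - ee (g (Suc n))) * c n) + ee (g m) * c (m - 1))
          + ee (g m) * (c m - c (m - 1))"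
        using m by (simp add: algebra_simps)
      then show ?thesis
        using Suc.IH [OF m(1,3)] n2 norm_triangle_ineq
          [of "(\<Sum>n = a..<m. (ee (g n) - ee (g (Suc n))) * c n) + ee (g m) * c (m - 1)"
              "ee (g m) * (c m - c (m - 1))"]
        by (simp add: field_simps)
    qed
  qed simp
  have b1: "a \<le> b - 1" "b - 1 < b" using True by auto
  have cot_a: "cot (pi * d a) \<ge> 0"
  proof -
    have "pi * d a \<le> pi * (1 / 2)" "0 \<le> pi * d a"
      using d [of a] True by (auto intro!: mult_left_mono simp del: mult_1_right times_divide_eq_right)
    then show ?thesis
      unfolding cot_def by (intro divide_nonneg_nonneg sin_ge_zero cos_ge_zero) (use pi_gt_zero in linarith)+
  qed
  have cot_b: "cot (pi * d (b - 1)) / 2 \<le> 1 / (4 * \<theta>)"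
  proof -
    have "\<bar>Im (c (b - 1))\<bar> \<le> 1 / (4 * \<theta>)"
      using abs_Im_le_cmod [of "c (b - 1)"] cb [OF b1] by linarith
    then show ?thesis by (simp add: c_def)
  qed
  have "(\<Sum>n = a..<b. ee (g n)) = (\<Sum>n = a..<b. (ee (g n) - ee (g (Suc n))) * c n)"
    by (intro sum.cong refl z) auto
  also have "\<dots> = ((\<Sum>n = a..<b. (ee (g n) - ee (g (Suc n))) * c n) + ee (g b) * c (b - 1))
       - ee (g b) * c (b - 1)" by simp
  also have "norm \<dots> \<le> 1 / (4 * \<theta>) + (cot (pi * d (b - 1)) - cot (pi * d a)) / 2 + 1 / (4 * \<theta>)"
    using main [OF True order_refl] cb [OF b1]
    by (intro order_trans [OF norm_triangle_ineq4] add_mono) (auto simp: norm_mult)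
  \<comment> \<open>The two boundary terms and half the cotangent at \<open>b - 1\<close> are at
    most 1/(4\<theta>) each, 3/(4\<theta>) together.\<close>
  also have "\<dots> \<le> 1 / \<theta>"
  proof -
    define q where "q = 1 / (4 * \<theta>)"
    have "1 / \<theta> = 4 * q" "q > 0" using th by (auto simp: q_def)
    then show ?thesis using cot_a cot_b unfolding q_def [symmetric] by (simp add: field_simps)
  qed
  finally show ?thesis .
qed (use th in auto)

section \<open>Iterated differences of y/u and van der Corput's inequality\<close>

text \<open>
  Up to sign, \<open>recip_diff y rs j\<close> is the iterated difference, with steps \<open>rs\<close>, of the \<open>j\<close>-th
  derivative of \<open>u \<mapsto> y / u\<close>.
\<close>

primrec recip_diff :: "real \<Rightarrow> nat list \<Rightarrow> nat \<Rightarrow> real \<Rightarrow> real" where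
  "recip_diff y [] j u = y * fact j / u ^ Suc j"
| "recip_diff y (r # rs) j u = recip_diff y rs j u - recip_diff y rs j (u + real r)"

lemma has_derivative_recip_diff:
  "u > 0 \<Longrightarrow> (recip_diff y rs j has_real_derivative - recip_diff y rs (Suc j) u) (at u)"
proof (induction rs arbitrary: u)
  case Nil
  have "((\<lambda>u. y * fact j / u ^ Suc j) has_real_derivative - (y * fact (Suc j) / u ^ Suc (Suc j))) (at u)"
    using Nil by (auto intro!: derivative_eq_intros simp: field_simps) (cases j; simp)
  then show ?case by (simp add: fun_eq_iff)
next
  case (Cons r rs)
  have "((\<lambda>u. recip_diff y rs j u - recip_diff y rs j (u + real r)) has_real_derivative
          - recip_diff y rs (Suc j) u - (- recip_diff y rs (Suc j) (u + real r)) * 1) (at u)"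
    using Cons.prems
    by (intro DERIV_diff Cons.IH DERIV_chain2 [where f = "recip_diff y rs j" and g = "\<lambda>u. u + real r"])
       (auto intro!: derivative_eq_intros)
  then show ?case by (simp add: algebra_simps)
qed

text \<open>By the mean value theorem a difference with step r is r times the next derivative at an
  intermediate point. Iterating trades each difference for a derivative and a factor r, with a final
  point between u and u plus the sum of the steps; the derivatives of y/u are monotone in absolute
  value.\<close>

lemma recip_diff_bounds:
  assumes "y \<ge> 0" "u > 0"
  shows "real (prod_list rs) * recip_diff y [] (j + length rs) (u + real (sum_list rs)) \<le> recip_diff y rs j u"
    and "recip_diff y rs j u \<le> real (prod_list rs) * recip_diff y [] (j + length rs) u"
proof -
  have mono: "recip_diff y [] i v \<le> recip_diff y [] i u" if "0 < u" "u \<le> v" for i u v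
    using that assms(1) by (auto intro!: divide_left_mono power_mono mult_mono zero_less_power)
  have "real (prod_list rs) * recip_diff y [] (j + length rs) (u + real (sum_list rs)) \<le> recip_diff y rs j u
      \<and> recip_diff y rs j u \<le> real (prod_list rs) * recip_diff y [] (j + length rs) u"
    using assms(2)
  proof (induction rs arbitrary: j u)
    case (Cons r rs)
    show ?case
    \<comment> \<open>The mean value theorem needs an interval of positive length; for step 0 all
      three quantities vanish.\<close>
    proof (cases "r = 0")
      case False
      have "\<exists>z>u. z < u + real r \<and>
          recip_diff y rs j (u + real r) - recip_diff y rs j u
            = (u + real r - u) * (- recip_diff y rs (Suc j) z)"
        using False Cons.prems by (intro MVT2 has_derivative_recip_diff) auto
      then obtain z where z: "u < z" "z < u + real r"
        and eq: "recip_diff y (r # rs) j u = real r * recip_diff y rs (Suc j) z"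
        by auto
      have "real (prod_list rs) * recip_diff y [] (Suc j + length rs) (z + real (sum_list rs)) \<le> recip_diff y rs (Suc j) z"
           "recip_diff y rs (Suc j) z \<le> real (prod_list rs) * recip_diff y [] (Suc j + length rs) z"
        using Cons.IH [of z "Suc j"] z Cons.prems by auto
      moreover have "real (prod_list rs) * recip_diff y [] (Suc j + length rs) (u + real (sum_list (r # rs)))
          \<le> real (prod_list rs) * recip_diff y [] (Suc j + length rs) (z + real (sum_list rs))"
        using z Cons.prems by (intro mult_left_mono mono) auto
      moreover have "real (prod_list rs) * recip_diff y [] (Suc j + length rs) z
          \<le> real (prod_list rs) * recip_diff y [] (Suc j + length rs) u"
        using z Cons.prems by (intro mult_left_mono mono) auto
      ultimately have "real (prod_list rs) * recip_diff y [] (Suc j + length rs) (u + real (sum_list (r # rs)))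
            \<le> recip_diff y rs (Suc j) z"
          "recip_diff y rs (Suc j) z \<le> real (prod_list rs) * recip_diff y [] (Suc j + length rs) u"
        by (auto simp del: recip_diff.simps)
      from mult_left_mono [OF this(1), of "real r"] mult_left_mono [OF this(2), of "real r"]
      show ?thesis
        unfolding eq by (simp add: algebra_simps del: recip_diff.simps)
    qed (use Cons.prems in simp)
  qed (use assms in auto)
  then show "real (prod_list rs) * recip_diff y [] (j + length rs) (u + real (sum_list rs)) \<le> recip_diff y rs j u"
    and "recip_diff y rs j u \<le> real (prod_list rs) * recip_diff y [] (j + length rs) u"
    by auto
qed


text \<open>H times the sum is the sum of the windows \<open>c m\<close> of length H.
  Cauchy--Schwarz over the b - a + H windows, followed by opening the squares, leaves the
  correlations of z with its shifts; only the H diagonal ones are estimated trivially.\<close>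

lemma van_der_Corput_inequality:
  fixes z :: "nat \<Rightarrow> complex"
  assumes H: "0 < H" "H \<le> a" "a \<le> b" and B: "0 \<le> B"
    and supp: "\<And>n. n \<notin> {a..<b} \<Longrightarrow> z n = 0" and z1: "\<And>n. norm (z n) \<le> 1"
    and corr: "\<And>r. 1 \<le> r \<Longrightarrow> r < H \<Longrightarrow> norm (\<Sum>n = a..<b. z (n + r) * cnj (z n)) \<le> B"
  shows "(norm (\<Sum>n = a..<b. z n))\<^sup>2 \<le> (real (b - a) + real H) * (real (b - a) / real H + B)"
proof -
  \<comment> \<open>Starting points of all windows that can meet the support. As H \<le> a, the
    subtraction on naturals is not truncated, and every point of the support is covered exactly H
    times.\<close>
  define I where "I = {a - H..<b}"
  define S where "S = (\<Sum>n = a..<b. z n)"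
  define c where "c m = (\<Sum>i<H. z (m + i))" for m
  have shift: "(\<Sum>m\<in>I. f (m + i)) = (\<Sum>n = a..<b. f n)"
    if "i < H" "\<And>n. n \<notin> {a..<b} \<Longrightarrow> f n = 0" for i and f :: "nat \<Rightarrow> complex"
  proof -
    have "(\<Sum>m\<in>I. f (m + i)) = (\<Sum>n = a - H + i..<b + i. f n)"
      unfolding I_def by (rule sum.shift_bounds_nat_ivl [symmetric])
    also have "\<dots> = (\<Sum>n = a..<b. f n)"
      using that H by (intro sum.mono_neutral_right) auto
    finally show ?thesis .
  qed
  have HS: "of_nat H * S = (\<Sum>m\<in>I. c m)"
  proof -
    have "(\<Sum>m\<in>I. c m) = (\<Sum>i<H. \<Sum>m\<in>I. z (m + i))"
      unfolding c_def by (rule sum.swap)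
    also have "\<dots> = (\<Sum>i<H. S)"
      unfolding S_def by (intro sum.cong refl shift supp) auto
    finally show ?thesis by simp
  qed
  define C where "C i j = (\<Sum>m\<in>I. z (m + i) * cnj (z (m + j)))" for i j
  have Cge: "norm (C i j) \<le> (if i = j then real (b - a) else B)" if "j \<le> i" "i < H" for i j
  proof -
    have "C i j = (\<Sum>m\<in>I. z (m + j + (i - j)) * cnj (z (m + j)))"
      using that by (simp add: C_def)
    also have "\<dots> = (\<Sum>n = a..<b. z (n + (i - j)) * cnj (z n))"
      using that by (intro shift [where f = "\<lambda>n. z (n + (i - j)) * cnj (z n)"]) (auto simp: supp)
    finally have eq: "C i j = (\<Sum>n = a..<b. z (n + (i - j)) * cnj (z n))" .
    show ?thesis
    proof (cases "i = j")
      case True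
      have "norm (C i j) \<le> (\<Sum>n = a..<b. 1)"
        unfolding eq using z1 True
        by (intro order_trans [OF norm_sum] sum_mono) (auto simp: norm_mult intro!: mult_le_one)
      then show ?thesis using True by simp
    next
      case False
      with that show ?thesis unfolding eq using corr [of "i - j"] by simp
    qed
  qed
  have Cle: "norm (C i j) \<le> (if i = j then real (b - a) else B)" if "i < H" "j < H" for i j
  proof (cases "j \<le> i")
    case False
    \<comment> \<open>Hermitian symmetry reduces negative shifts to positive ones.\<close>
    have "C i j = cnj (C j i)" by (simp add: C_def mult.commute)
    with Cge [of i j] False that show ?thesis
      by (metis Cge complex_mod_cnj nat_le_linear)
  qed (use Cge that in auto)
  have "complex_of_real (\<Sum>m\<in>I. (norm (c m))\<^sup>2) = (\<Sum>m\<in>I. \<Sum>i<H. \<Sum>j<H. z (m + i) * cnj (z (m + j)))"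
    by (simp add: complex_norm_square c_def sum_product cnj_sum del: of_real_power)
  also have "\<dots> = (\<Sum>i<H. \<Sum>m\<in>I. \<Sum>j<H. z (m + i) * cnj (z (m + j)))"
    by (rule sum.swap)
  also have "\<dots> = (\<Sum>i<H. \<Sum>j<H. C i j)"
    unfolding C_def by (intro sum.cong refl sum.swap)
  finally have "norm (complex_of_real (\<Sum>m\<in>I. (norm (c m))\<^sup>2)) = norm (\<Sum>i<H. \<Sum>j<H. C i j)"
    by (rule arg_cong)
  then have "(\<Sum>m\<in>I. (norm (c m))\<^sup>2) = norm (\<Sum>i<H. \<Sum>j<H. C i j)"
    unfolding norm_of_real by (simp add: sum_nonneg)
  also have "\<dots> \<le> (\<Sum>i<H. \<Sum>j<H. (if i = j then real (b - a) else B))"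
    by (intro order_trans [OF norm_sum] sum_mono Cle) auto
  also have "\<dots> \<le> (\<Sum>i<H. \<Sum>j<H. (if i = j then real (b - a) else 0) + B)"
    using B by (intro sum_mono) auto
  also have "\<dots> = real H * real (b - a) + real H * real H * B"
    by (simp add: sum.distrib algebra_simps)
  finally have sq: "(\<Sum>m\<in>I. (norm (c m))\<^sup>2) \<le> real H * real (b - a) + real H * real H * B" .
  have "(real H * norm S)\<^sup>2 = (norm (\<Sum>m\<in>I. c m))\<^sup>2"
    by (simp add: norm_mult flip: HS)
  also have "\<dots> \<le> (\<Sum>m\<in>I. norm (c m))\<^sup>2"
    by (intro power_mono norm_sum) auto
  also have "\<dots> \<le> (\<Sum>m\<in>I. (norm (c m))\<^sup>2) * real (card I)"
    by (rule sum_squared_le_sum_of_squares)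
  also have "\<dots> \<le> (real H * real (b - a) + real H * real H * B) * (real (b - a) + real H)"
    using H B sq by (intro mult_mono) (auto simp: I_def intro!: sum_nonneg add_nonneg_nonneg mult_nonneg_nonneg)
  also have "\<dots> = (real H)\<^sup>2 * ((real (b - a) + real H) * (real (b - a) / real H + B))"
    using H by (simp add: field_simps power2_eq_square)
  finally have "(real H)\<^sup>2 * (norm S)\<^sup>2 \<le> (real H)\<^sup>2 * ((real (b - a) + real H) * (real (b - a) / real H + B))"
    by (simp add: power_mult_distrib)
  then show ?thesis
    using H by (simp add: S_def)
qed

text \<open>Extending the terms by 0 outside the interval shortens the correlation sums to
  \<open>{a..<b - r}\<close>. The phase F(n) - F(n+r) belongs to the conjugate of the correlation;
  with this sign differencing \<open>recip_diff\<close> yields \<open>recip_diff\<close>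
  again.\<close>

lemma van_der_Corput_ee:
  fixes F :: "nat \<Rightarrow> real"
  assumes H: "0 < H" "H \<le> a" "a \<le> b" and B: "0 \<le> B"
    and corr: "\<And>r. 1 \<le> r \<Longrightarrow> r < H \<Longrightarrow> norm (\<Sum>n = a..<b - r. ee (F n - F (n + r))) \<le> B"
  shows "(norm (\<Sum>n = a..<b. ee (F n)))\<^sup>2 \<le> (real (b - a) + real H) * (real (b - a) / real H + B)"
proof -
  define z where "z n = (if n \<in> {a..<b} then ee (F n) else 0)" for n
  have "norm (\<Sum>n = a..<b. z (n + r) * cnj (z n)) \<le> B" if "1 \<le> r" "r < H" for r
  proof -
    have "(\<Sum>n = a..<b. z (n + r) * cnj (z n)) = (\<Sum>n = a..<b - r. z (n + r) * cnj (z n))"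
      by (intro sum.mono_neutral_right) (auto simp: z_def)
    also have "\<dots> = (\<Sum>n = a..<b - r. cnj (ee (F n - F (n + r))))"
      by (intro sum.cong refl) (auto simp: z_def ee_diff)
    also have "norm \<dots> = norm (\<Sum>n = a..<b - r. ee (F n - F (n + r)))"
      by (simp flip: cnj_sum)
    finally show ?thesis using corr that by simp
  qed
  then have "(norm (\<Sum>n = a..<b. z n))\<^sup>2 \<le> (real (b - a) + real H) * (real (b - a) / real H + B)"
    by (intro van_der_Corput_inequality H B) (auto simp: z_def)
  then show ?thesis by (simp add: z_def)
qed

lemma recip_diff_nonneg: "y \<ge> 0 \<Longrightarrow> u > 0 \<Longrightarrow> recip_diff y rs j u \<ge> 0"
  by (rule order_trans [OF _ recip_diff_bounds(1)]) auto

lemma prod_list_ge_1: "(\<And>r. r \<in> set rs \<Longrightarrow> 1 \<le> r) \<Longrightarrow> 1 \<le> prod_list (rs :: nat list)"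
proof (induction rs)
  case (Cons r rs)
  then have "1 * 1 \<le> r * prod_list rs" by (intro mult_le_mono) auto
  then show ?case by simp
qed auto

lemma prod_list_le_power: "(\<And>r. r \<in> set rs \<Longrightarrow> r \<le> H) \<Longrightarrow> prod_list (rs :: nat list) \<le> H ^ length rs"
  by (induction rs) (auto intro!: mult_le_mono)

lemma sum_list_le_mult: "(\<And>r. r \<in> set rs \<Longrightarrow> r \<le> H) \<Longrightarrow> sum_list (rs :: nat list) \<le> length rs * H"
  by (induction rs) (auto intro!: add_mono)

text \<open>Induction on the number j of differencing steps still to come; \<open>rs\<close> holds
  the steps already taken. At j = 0 Kusmin--Landau applies: \<open>c2\<close> keeps the decrements
  below 1/2 and \<open>c1\<close> turns its bound into v/H. Each van der Corput step halves the
  exponent of the saving.\<close>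

lemma exp_sum_recip_diff:
  fixes y :: real
  assumes y: "y > 0" and H: "1 \<le> H" "H \<le> A" "A \<le> v"
    and c1: "real (k + 1) ^ (k + 2) * real v ^ (k + 1) * real H \<le> y"
    and c2: "2 * real H ^ k * fact (k + 1) * y \<le> real A ^ (k + 2)"
    and rs: "length rs + j = k" "set rs \<subseteq> {1..H}" and ab: "A \<le> a" "a \<le> b" "b \<le> v"
  shows "norm (\<Sum>n = a..<b. ee (recip_diff y rs 0 (real n))) \<le> 2 * real v * real H powr (- (1 / 2 ^ j))"
  using rs ab
proof (induction j arbitrary: rs a b)
  case 0
  \<comment> \<open>Lower bound for the decrements: n + 1 and the k steps, each at most H \<le> v,
    add up to at most (k+1)v, and the product of the steps times (k+1)! is at least 1.\<close>
  define \<theta> where "\<theta> = y / (real (k + 1) * real v) ^ (k + 2)"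
  have v: "v \<ge> 1" using H by auto
  have th: "\<theta> > 0" using y v by (simp add: \<theta>_def)
  \<comment> \<open>The decrement is one more difference, with step 1, so the bounds for
    \<open>recip_diff\<close> apply to it; a further step 1 shows below that the decrements
    decrease.\<close>
  have step: "recip_diff y rs 0 (real n) - recip_diff y rs 0 (real (Suc n)) = recip_diff y (1 # rs) 0 (real n)"
    for n by (simp add: add.commute)
  have len: "length rs = k" using 0 by simp
  have p1: "1 \<le> prod_list (1 # rs)" using 0 by (intro prod_list_ge_1) auto
  have pH: "real (prod_list (1 # rs)) \<le> real H ^ k"
    using prod_list_le_power [of rs H] 0 len by (auto simp: subset_iff simp flip: of_nat_power)
  have "norm (\<Sum>n = a..<b. ee (recip_diff y rs 0 (real n))) \<le> 1 / \<theta>"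
  proof (rule Kusmin_Landau [OF th])
    fix n assume n: "a \<le> n" "n < b"
    then have n0: "0 < real n" using 0 H by auto
    have "sum_list rs \<le> k * H"
      using sum_list_le_mult [of rs H] 0 len by (auto simp: subset_iff)
    also have "\<dots> \<le> k * v" using H by auto
    finally have "n + sum_list (1 # rs) \<le> (k + 1) * v" using n 0 by simp
    then have s: "real n + real (sum_list (1 # rs)) \<le> real (k + 1) * real v"
      by (metis of_nat_add of_nat_le_iff of_nat_mult)
    have "\<theta> \<le> y / (real n + real (sum_list (1 # rs))) ^ (k + 2)"
      unfolding \<theta>_def using s n0 y v by (intro divide_left_mono power_mono mult_pos_pos zero_less_power) auto
    also have "\<dots> \<le> real (prod_list (1 # rs)) * (y * fact (k + 1) / (real n + real (sum_list (1 # rs))) ^ (k + 2))"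
    proof -
      have "1 * 1 \<le> real (prod_list (1 # rs)) * (fact (k + 1) :: real)"
        using p1 by (intro mult_mono fact_ge_1) auto
      then have "y * 1 \<le> y * (real (prod_list (1 # rs)) * fact (k + 1))"
        using y by (intro mult_left_mono) auto
      then have "(y * 1) / (real n + real (sum_list (1 # rs))) ^ (k + 2)
         \<le> (y * (real (prod_list (1 # rs)) * fact (k + 1))) / (real n + real (sum_list (1 # rs))) ^ (k + 2)"
        using n0 by (intro divide_right_mono) auto
      then show ?thesis by (simp only: mult_1_right mult_ac times_divide_eq_right)
    qed
    also have "\<dots> \<le> recip_diff y (1 # rs) 0 (real n)"
      using recip_diff_bounds(1) [of y "real n" "1 # rs" 0] y n0 len by simp
    finally show "\<theta> \<le> recip_diff y rs 0 (real n) - recip_diff y rs 0 (real (Suc n))"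
      by (simp only: step)
    have "recip_diff y (1 # rs) 0 (real n) \<le> real (prod_list (1 # rs)) * (y * fact (k + 1) / real n ^ (k + 2))"
      using recip_diff_bounds(2) [of y "real n" "1 # rs" 0] y n0 len by simp
    also have "\<dots> \<le> real H ^ k * (y * fact (k + 1) / real A ^ (k + 2))"
      using pH y n0 n 0 H
      by (intro mult_mono divide_left_mono power_mono mult_pos_pos zero_less_power) auto
    also have "\<dots> \<le> 1 / 2"
      using c2 H by (simp add: field_simps)
    finally show "recip_diff y rs 0 (real n) - recip_diff y rs 0 (real (Suc n)) \<le> 1 / 2"
      by (simp only: step)
  next
    fix n assume "a \<le> n" "Suc n < b"
    then have n0: "0 < real n" using 0 H by auto
    have "0 \<le> recip_diff y (1 # 1 # rs) 0 (real n)"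
      using n0 y by (intro recip_diff_nonneg) auto
    then show "recip_diff y rs 0 (real (Suc n)) - recip_diff y rs 0 (real (Suc (Suc n)))
        \<le> recip_diff y rs 0 (real n) - recip_diff y rs 0 (real (Suc n))"
      by (simp add: add_ac)
  qed
  also have "1 / \<theta> = real (k + 1) ^ (k + 2) * real v ^ (k + 2) / y"
    by (simp only: \<theta>_def power_mult_distrib divide_divide_eq_right mult_1_left)
  also have "\<dots> \<le> real v / real H"
  proof -
    have "real v * (real (k + 1) ^ (k + 2) * real v ^ (k + 1) * real H) \<le> real v * y"
      using c1 by (intro mult_left_mono) auto
    then show ?thesis using y H by (simp add: field_simps)
  qed
  also have "\<dots> \<le> 2 * real v * real H powr (- (1 / 2 ^ 0))"
    using H by (simp add: powr_minus_divide divide_right_mono)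
  finally show ?case .
next
  case (Suc j)
  define e :: real where "e = 1 / 2 ^ j"
  have e: "0 < e" "e \<le> 1" by (auto simp: e_def)
  have "(norm (\<Sum>n = a..<b. ee (recip_diff y rs 0 (real n))))\<^sup>2
      \<le> (real (b - a) + real H) * (real (b - a) / real H + 2 * real v * real H powr (- e))"
  proof (rule van_der_Corput_ee)
    fix r assume r: "1 \<le> r" "r < H"
    show "norm (\<Sum>n = a..<b - r. ee (recip_diff y rs 0 (real n) - recip_diff y rs 0 (real (n + r))))
        \<le> 2 * real v * real H powr - e"
    \<comment> \<open>Otherwise the shortened sum is empty.\<close>
    proof (cases "a \<le> b - r")
      case True
      then show ?thesis
        using Suc.IH [of "r # rs" a "b - r"] Suc.prems r by (auto simp: e_def)
    qed auto
  qed (use Suc.prems H in auto)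
  also have "\<dots> \<le> real v * (real v * real H powr (- e) + 2 * real v * real H powr (- e))"
  proof (intro mult_mono add_mono)
    show "real (b - a) + real H \<le> real v" using Suc.prems H by auto
    have "real (b - a) / real H \<le> real v * real H powr (- 1)"
      using Suc.prems H by (auto simp: powr_minus_divide intro!: divide_right_mono)
    also have "\<dots> \<le> real v * real H powr (- e)"
      using e H by (intro mult_left_mono powr_mono) auto
    finally show "real (b - a) / real H \<le> real v * real H powr (- e)" .
  qed auto
  \<comment> \<open>The constant 2 of the claim reproduces itself because 1 + 2 \<le> 2^2.\<close>
  also have "\<dots> \<le> 4 * (real v)\<^sup>2 * real H powr (- e)"
    by (simp add: power2_eq_square algebra_simps)
  also have "\<dots> = (2 * real v * real H powr (- (1 / 2 ^ Suc j)))\<^sup>2"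
    by (simp add: power_mult_distrib power2_eq_square e_def flip: powr_add)
  finally show ?case
    by (rule power2_le_imp_le) auto
qed

section \<open>Exponential sums with weights 1/n over explicit ranges\<close>

lemma sum_divide_by_parts:
  fixes f :: "nat \<Rightarrow> complex"
  assumes A: "1 \<le> A" "A \<le> v" and c: "0 \<le> c"
    and U: "\<And>b. A \<le> b \<Longrightarrow> b \<le> v \<Longrightarrow> norm (\<Sum>n = A..<b. f n) \<le> c * real b"
  shows "norm (\<Sum>n = A..<v. f n / of_nat n) \<le> c * (1 + (\<Sum>n = A..<v. 1 / real n))"
proof -
  define u where "u b = (\<Sum>n = A..<b. f n)" for b
  \<comment> \<open>Abel summation; 1/n - 1/(n+1) = 1/(n(n+1)) is the weight of the partial sum
    \<open>u (Suc n)\<close>.\<close>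
  have "(\<Sum>n = A..<v. f n / of_nat n) = u v / of_nat v + (\<Sum>n = A..<v. u (Suc n) / (of_nat n * of_nat (Suc n)))"
    using A(2)
  proof (induction v rule: dec_induct)
    case (step v)
    have f: "f v = u (Suc v) - u v" using step by (simp add: u_def)
    have "(of_nat v :: complex) \<noteq> 0" "(1 + of_nat v :: complex) \<noteq> 0"
      using A step by (auto simp flip: of_nat_Suc)
    then have "u (Suc v) / (1 + of_nat v) + u (Suc v) / (of_nat v * (1 + of_nat v)) = u (Suc v) / of_nat v"
      by (simp add: divide_simps) (simp add: algebra_simps)
    then have "f v / of_nat v + u v / of_nat v
        = u (Suc v) / (1 + of_nat v) + u (Suc v) / (of_nat v * (1 + of_nat v))"
      by (simp add: f diff_divide_distrib)
    with step show ?case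
      by (simp add: algebra_simps)
  qed (simp add: u_def)
  also have "norm \<dots> \<le> c + (\<Sum>n = A..<v. c * (1 / real n))"
  proof (intro order_trans [OF norm_triangle_ineq] add_mono order_trans [OF norm_sum] sum_mono)
    show "norm (u v / of_nat v) \<le> c"
      using U [of v] A by (simp add: u_def norm_divide field_simps)
    fix n assume n: "n \<in> {A..<v}"
    have "norm (u (Suc n)) \<le> c * real (Suc n)"
      using U [of "Suc n"] n by (simp add: u_def)
    then have "norm (u (Suc n)) / (real n * real (Suc n)) \<le> c * real (Suc n) / (real n * real (Suc n))"
      by (intro divide_right_mono) auto
    also have "\<dots> = c * (1 / real n)" by (simp del: of_nat_Suc)
    finally show "norm (u (Suc n) / (of_nat n * of_nat (Suc n))) \<le> c * (1 / real n)"
      by (simp add: norm_divide norm_mult del: of_nat_Suc)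
  qed
  finally show ?thesis by (simp add: algebra_simps sum_distrib_left)
qed

text \<open>Condition \<open>c1\<close> persists when v is replaced by a smaller b, so every partial
  sum has a bound proportional to b, as summation by parts requires.\<close>

lemma weighted_exp_sum_bound:
  fixes y :: real
  assumes y: "y > 0" and H: "1 \<le> H" "H \<le> A" "A \<le> v"
    and c1: "real (k + 1) ^ (k + 2) * real v ^ (k + 1) * real H \<le> y"
    and c2: "2 * real H ^ k * fact (k + 1) * y \<le> real A ^ (k + 2)"
  shows "norm (\<Sum>n = A..<v. ee (y / real n) / of_nat n)
           \<le> 2 * real H powr (- (1 / 2 ^ k)) * (1 + (\<Sum>n = A..<v. 1 / real n))"
proof (rule sum_divide_by_parts)
  fix b assume b: "A \<le> b" "b \<le> v"
  have "real (k + 1) ^ (k + 2) * real b ^ (k + 1) * real H \<le> real (k + 1) ^ (k + 2) * real v ^ (k + 1) * real H"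
    using b by (intro mult_mono power_mono) auto
  then have "real (k + 1) ^ (k + 2) * real b ^ (k + 1) * real H \<le> y"
    using c1 by linarith
  from exp_sum_recip_diff [OF y H(1,2) b(1) this c2, of "[]" k A b] b
  show "norm (\<Sum>n = A..<b. ee (y / real n)) \<le> 2 * real H powr - (1 / 2 ^ k) * real b"
    by (simp add: mult_ac)
qed (use H in auto)

lemma sum_inverse_bounds:
  assumes "1 \<le> a" "a \<le> b"
  shows "ln (real b) - ln (real a) \<le> (\<Sum>n = a..<b. 1 / real n)"
    and "(\<Sum>n = a..<b. 1 / real n) \<le> 1 + ln (real b) - ln (real a)"
proof -
  \<comment> \<open>The slack 1 is sharpened to 1/a - 1/b so that the upper bound survives the
    induction step, by 1/(b+1) \<le> ln(b+1) - ln b.\<close>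
  have *: "ln (real b) - ln (real a) \<le> (\<Sum>n = a..<b. 1 / real n) \<and>
      (\<Sum>n = a..<b. 1 / real n) \<le> ln (real b) - ln (real a) + (1 / real a - 1 / real b)"
    using assms(2)
  proof (induction b rule: dec_induct)
    case (step b)
    have b: "real b > 0" using assms step by auto
    have "ln (1 + 1 / real b) \<le> 1 / real b"
      by (rule ln_add_one_self_le_self) auto
    then have 1: "ln (real (Suc b)) - ln (real b) \<le> 1 / real b"
    proof -
      have "1 + 1 / real b = real (Suc b) / real b" using b by (simp add: field_simps)
      then show ?thesis using b \<open>ln (1 + 1 / real b) \<le> 1 / real b\<close> by (simp add: ln_div)
    qed
    have "ln (real b / real (Suc b)) \<le> real b / real (Suc b) - 1"
      using b by (intro ln_le_minus_one) auto
    then have "1 / real (Suc b) \<le> ln (real (Suc b)) - ln (real b)"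
      using b by (simp add: ln_div field_simps)
    with 1 step show ?case by (simp add: sum.atLeastLessThan_Suc)
  qed (use assms in auto)
  moreover have "1 / real a - 1 / real b \<le> 1"
    using assms by (smt (verit) divide_le_eq_1 of_nat_0_le_iff of_nat_1 of_nat_mono zero_le_divide_1_iff)
  ultimately show "ln (real b) - ln (real a) \<le> (\<Sum>n = a..<b. 1 / real n)"
    and "(\<Sum>n = a..<b. 1 / real n) \<le> 1 + ln (real b) - ln (real a)"
    by linarith+
qed

definition powr_range :: "real \<Rightarrow> real \<Rightarrow> real \<Rightarrow> nat set" where
  "powr_range \<alpha> \<beta> x = {nat \<lceil>x powr \<alpha>\<rceil>..<nat \<lfloor>x powr \<beta>\<rfloor>}"

text \<open>The choice H = [x^\<delta>] turns all conditions into inequalities between powers of x.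
  The phase parameter y may range around x because it will be h x / q with h and q bounded by powers
  of ln x. For k \<le> 2 the saving is at least H^(-1/4), and H \<ge> x^\<delta> / 2.\<close>

lemma weighted_exp_sum_powr_range:
  fixes x y \<alpha> \<beta> \<delta> :: real
  assumes x: "1 \<le> x" and k: "k \<le> 2"
    and c1: "real (k + 1) ^ (k + 2) * (x powr \<beta>) ^ (k + 1) * x powr \<delta> \<le> x powr (1 - \<delta>)"
    and c2: "2 * (x powr \<delta>) ^ k * fact (k + 1) * x powr (1 + \<delta>) \<le> (x powr \<alpha>) ^ (k + 2)"
    and c3: "2 \<le> x powr \<delta>" "x powr \<delta> \<le> x powr \<alpha>" "x powr \<alpha> + 2 \<le> x powr \<beta>" "x powr \<beta> \<le> x"
    and y: "x powr (1 - \<delta>) \<le> y" "y \<le> x powr (1 + \<delta>)"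
  shows "norm (\<Sum>n\<in>powr_range \<alpha> \<beta> x. ee (y / real n) / of_nat n)
           \<le> 2 * (x powr \<delta> / 2) powr (- (1 / 4)) * (2 + ln x)"
proof -
  define A where "A = nat \<lceil>x powr \<alpha>\<rceil>"
  define v where "v = nat \<lfloor>x powr \<beta>\<rfloor>"
  define H where "H = nat \<lfloor>x powr \<delta>\<rfloor>"
  have A: "x powr \<alpha> \<le> real A" "real A \<le> x powr \<alpha> + 1" unfolding A_def using powr_ge_zero [of x \<alpha>] by linarith+
  have v: "real v \<le> x powr \<beta>" "x powr \<beta> \<le> real v + 1" unfolding v_def using c3 by linarith+
  have H: "real H \<le> x powr \<delta>" "x powr \<delta> \<le> real H + 1" unfolding H_def using c3 by linarith+
  have HA: "1 \<le> H" "H \<le> A" "A \<le> v" "1 \<le> A"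
    using A v H c3 by linarith+
  have y0: "y > 0" using y x by (smt (verit) powr_gt_zero)
  have "norm (\<Sum>n = A..<v. ee (y / real n) / of_nat n)
           \<le> 2 * real H powr (- (1 / 2 ^ k)) * (1 + (\<Sum>n = A..<v. 1 / real n))"
  proof (rule weighted_exp_sum_bound [OF y0 HA(1-3)])
    have "real (k + 1) ^ (k + 2) * real v ^ (k + 1) * real H
        \<le> real (k + 1) ^ (k + 2) * (x powr \<beta>) ^ (k + 1) * x powr \<delta>"
      using v H by (intro mult_mono power_mono) auto
    also note c1
    also note y(1)
    finally show "real (k + 1) ^ (k + 2) * real v ^ (k + 1) * real H \<le> y" .
    have "2 * real H ^ k * fact (k + 1) * y \<le> 2 * (x powr \<delta>) ^ k * fact (k + 1) * x powr (1 + \<delta>)"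
      using H y y0 by (intro mult_mono power_mono) auto
    also note c2
    also have "(x powr \<alpha>) ^ (k + 2) \<le> real A ^ (k + 2)"
      using A by (intro power_mono) auto
    finally show "2 * real H ^ k * fact (k + 1) * y \<le> real A ^ (k + 2)" .
  qed
  also have "\<dots> \<le> 2 * (x powr \<delta> / 2) powr (- (1 / 4)) * (2 + ln x)"
  proof (intro mult_mono)
    have "(1 / 4 :: real) \<le> 1 / 2 ^ k"
      using power_increasing [OF k, of "2 :: real"] by (simp add: field_simps)
    then have "real H powr (- (1 / 2 ^ k)) \<le> real H powr (- (1 / 4))"
      using HA by (intro powr_mono) auto
    also have "\<dots> \<le> (x powr \<delta> / 2) powr (- (1 / 4))"
      using H c3 HA by (intro powr_mono2') auto
    finally show "real H powr (- (1 / 2 ^ k)) \<le> (x powr \<delta> / 2) powr (- (1 / 4))" .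
    have "(\<Sum>n = A..<v. 1 / real n) \<le> 1 + ln (real v) - ln (real A)"
      using HA by (intro sum_inverse_bounds) auto
    also have "\<dots> \<le> 1 + ln x"
    proof -
      have "ln (real v) \<le> ln x" using v c3 HA by (subst ln_le_cancel_iff) auto
      moreover have "ln (real A) \<ge> 0" using HA by (intro ln_ge_zero) auto
      ultimately show ?thesis by linarith
    qed
    finally show "1 + (\<Sum>n = A..<v. 1 / real n) \<le> 2 + ln x" by simp
  qed (use x in \<open>auto intro!: sum_nonneg add_nonneg_nonneg\<close>)
  finally show ?thesis by (simp add: powr_range_def A_def v_def)
qed

text \<open>
  The three ranges are the ones on which zero, one and two Weyl differencing steps turn the phase
  \<open>x / n\<close> into one whose increments are small but not too small.  They cover a proportion \<open>7 / 10\<close>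
  of the logarithmic scale, which exceeds \<open>285 / 416\<close>.
\<close>

definition bulk :: "real \<Rightarrow> nat set" where
  "bulk x = powr_range (51/100) (99/100) x \<union> (powr_range (34/100) (49/100) x \<union> powr_range (26/100) (33/100) x)"

lemma powr_range_disjoint:
  assumes "1 \<le> x" "\<beta> \<le> \<alpha>"
  shows "powr_range \<alpha> \<beta>' x \<inter> powr_range \<alpha>' \<beta> x = {}"
proof -
  have "x powr \<beta> \<le> x powr \<alpha>" using assms by (intro powr_mono) auto
  then have "nat \<lfloor>x powr \<beta>\<rfloor> \<le> nat \<lceil>x powr \<alpha>\<rceil>" by linarith
  then show ?thesis by (auto simp: powr_range_def)
qed

lemma finite_powr_range [simp]: "finite (powr_range \<alpha> \<beta> x)"
  by (simp add: powr_range_def)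

lemma finite_bulk [simp]: "finite (bulk x)"
  by (simp add: bulk_def)

lemma sum_bulk:
  fixes f :: "nat \<Rightarrow> 'a::comm_monoid_add"
  assumes "1 \<le> x"
  shows "(\<Sum>n\<in>bulk x. f n) = (\<Sum>n\<in>powr_range (51/100) (99/100) x. f n)
    + ((\<Sum>n\<in>powr_range (34/100) (49/100) x. f n) + (\<Sum>n\<in>powr_range (26/100) (33/100) x. f n))"
  unfolding bulk_def
  by (subst sum.union_disjoint | simp add: powr_range_disjoint Int_Un_distrib assms)+

text \<open>The gaps between the exponents of the ranges leave room for \<delta> = 1/1000 in every
  condition. The resulting saving, of order x^(-1/4000) up to a logarithm, beats any power of ln x;
  the 20th is ample for what follows.\<close>

lemma weighted_exp_sum_bulk:
  "\<forall>\<^sub>F x in at_top. \<forall>y. x powr (1 - 1/1000) \<le> y \<and> y \<le> x powr (1 + 1/1000) \<longrightarrow>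
     norm (\<Sum>n\<in>bulk x. ee (y / real n) / of_nat n) \<le> 1 / ln x ^ 20"
proof -
  have e0: "\<forall>\<^sub>F x::real in at_top. real (0 + 1) ^ (0 + 2) * (x powr (99/100)) ^ (0 + 1) * x powr (1/1000) \<le> x powr (1 - 1/1000)"
    by simp real_asymp
  have f0: "\<forall>\<^sub>F x::real in at_top. 2 * (x powr (1/1000)) ^ 0 * fact (0 + 1) * x powr (1 + 1/1000) \<le> (x powr (51/100)) ^ (0 + 2)"
    by (simp add: fact_numeral) real_asymp
  have e1: "\<forall>\<^sub>F x::real in at_top. real (1 + 1) ^ (1 + 2) * (x powr (49/100)) ^ (1 + 1) * x powr (1/1000) \<le> x powr (1 - 1/1000)"
    by simp real_asymp
  have f1: "\<forall>\<^sub>F x::real in at_top. 2 * (x powr (1/1000)) ^ 1 * fact (1 + 1) * x powr (1 + 1/1000) \<le> (x powr (34/100)) ^ (1 + 2)"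
    by (simp add: fact_numeral) real_asymp
  have e2: "\<forall>\<^sub>F x::real in at_top. real (2 + 1) ^ (2 + 2) * (x powr (33/100)) ^ (2 + 1) * x powr (1/1000) \<le> x powr (1 - 1/1000)"
    by simp real_asymp
  have f2: "\<forall>\<^sub>F x::real in at_top. 2 * (x powr (1/1000)) ^ 2 * fact (2 + 1) * x powr (1 + 1/1000) \<le> (x powr (26/100)) ^ (2 + 2)"
    by (simp add: fact_numeral) real_asymp
  have g: "\<forall>\<^sub>F x::real in at_top. 2 \<le> x powr (1/1000)" by real_asymp
  have h0: "\<forall>\<^sub>F x::real in at_top. x powr (51/100) + 2 \<le> x powr (99/100)" by real_asymp
  have h1: "\<forall>\<^sub>F x::real in at_top. x powr (34/100) + 2 \<le> x powr (49/100)" by real_asymp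
  have h2: "\<forall>\<^sub>F x::real in at_top. x powr (26/100) + 2 \<le> x powr (33/100)" by real_asymp
  have fin: "\<forall>\<^sub>F x::real in at_top. 3 * (2 * (x powr (1/1000) / 2) powr (- (1 / 4)) * (2 + ln x)) \<le> 1 / ln x ^ 20"
    by real_asymp
  show ?thesis
    using e0 e1 e2 f0 f1 f2 g h0 h1 h2 fin eventually_ge_at_top [of 1]
  proof eventually_elim
    case (elim x)
    note e0 = elim(1) and e1 = elim(2) and e2 = elim(3) and f0 = elim(4) and f1 = elim(5) and f2 = elim(6)
      and g = elim(7) and h0 = elim(8) and h1 = elim(9) and h2 = elim(10)
    have le: "x powr (99/100) \<le> x powr 1" "x powr (49/100) \<le> x powr 1" "x powr (33/100) \<le> x powr 1"
      "x powr (1/1000) \<le> x powr (51/100)" "x powr (1/1000) \<le> x powr (34/100)" "x powr (1/1000) \<le> x powr (26/100)"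
      using elim by (intro powr_mono; simp)+
    have x: "1 \<le> x" "x powr 1 = x" using elim by auto
    show ?case
    proof (intro allI impI)
      fix y assume "x powr (1 - 1/1000) \<le> y \<and> y \<le> x powr (1 + 1/1000)"
      then have y: "x powr (1 - 1/1000) \<le> y" "y \<le> x powr (1 + 1/1000)" by auto
      let ?B = "2 * (x powr (1/1000) / 2) powr (- (1 / 4)) * (2 + ln x)"
      let ?S = "\<lambda>\<alpha> \<beta>. \<Sum>n\<in>powr_range \<alpha> \<beta> x. ee (y / real n) / of_nat n"
      have "norm (?S (51/100) (99/100)) \<le> ?B"
        by (rule weighted_exp_sum_powr_range [OF x(1) _ e0 f0 g le(4) h0 _ y(1,2)])
           (use le x in auto)
      moreover have "norm (?S (34/100) (49/100)) \<le> ?B"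
        by (rule weighted_exp_sum_powr_range [OF x(1) _ e1 f1 g le(5) h1 _ y(1,2)])
           (use le x in auto)
      moreover have "norm (?S (26/100) (33/100)) \<le> ?B"
        by (rule weighted_exp_sum_powr_range [OF x(1) _ e2 f2 g le(6) h2 _ y(1,2)])
           (use le x in auto)
      moreover have "norm (\<Sum>n\<in>bulk x. ee (y / real n) / of_nat n)
          \<le> norm (?S (51/100) (99/100)) + (norm (?S (34/100) (49/100)) + norm (?S (26/100) (33/100)))"
        unfolding sum_bulk [OF x(1)]
        by (intro order_trans [OF norm_triangle_ineq] add_left_mono norm_triangle_ineq)
      ultimately show "norm (\<Sum>n\<in>bulk x. ee (y / real n) / of_nat n) \<le> 1 / ln x ^ 20"
        using elim by linarith
    qed
  qed
qed

section \<open>Equidistribution\<close>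

text \<open>The Fejer kernel in its closed form: for L > 0 it has mean value 1 over a period, and
  its peak at the integers has height L.\<close>

definition fejer :: "nat \<Rightarrow> real \<Rightarrow> real" where
  "fejer L u = (norm (\<Sum>j<L. ee (real j * u)))\<^sup>2 / real L"

lemma fejer_nonneg: "0 \<le> fejer L u"
  by (simp add: fejer_def)

lemma fejer_expand:
  "complex_of_real (fejer L u) = (\<Sum>i<L. \<Sum>j<L. ee ((real i - real j) * u)) / of_nat L"
proof -
  have "complex_of_real ((norm (\<Sum>j<L. ee (real j * u)))\<^sup>2) = (\<Sum>i<L. \<Sum>j<L. ee ((real i - real j) * u))"
    unfolding complex_norm_square by (simp add: cnj_sum sum_product left_diff_distrib ee_diff)
  then show ?thesis by (simp add: fejer_def)
qed

text \<open>A geometric sum is at most 2 / |1 - e(u)|, and |1 - e(u)| \<ge> 4d when u stays d away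
  from the integers.\<close>

lemma norm_sum_ee_le:
  assumes d: "0 < d" "d \<le> u" "u \<le> 1 - d"
  shows "norm (\<Sum>j<L. ee (real j * u)) \<le> 1 / (2 * d)"
proof -
  have "2 * d \<le> sin (pi * u)"
  proof (cases "u \<le> 1 / 2")
    case True
    then show ?thesis using sin_pi_ge [of u] d by simp
  next
    case False
    have "sin (pi * u) = sin (pi * (1 - u))"
      by (simp add: right_diff_distrib)
    moreover have "2 * (1 - u) \<le> sin (pi * (1 - u))"
      using False d by (intro sin_pi_ge) auto
    ultimately show ?thesis using d by simp
  qed
  then have n: "4 * d \<le> norm (1 - ee u)"
    by (simp add: norm_one_minus_ee)
  then have ne: "ee u \<noteq> 1" using d by auto
  have "(\<Sum>j<L. ee (real j * u)) = (\<Sum>j<L. ee u ^ j)"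
    by (simp add: ee_power)
  also have "\<dots> = (1 - ee u ^ L) / (1 - ee u)"
    using ne by (simp add: sum_gp_strict)
  also have "norm \<dots> \<le> 2 / (4 * d)"
    unfolding norm_divide using n d norm_triangle_ineq4 [of 1 "ee u ^ L"]
    by (intro frac_le) (auto simp: norm_power)
  finally show ?thesis by simp
qed

lemma fejer_minus: "fejer L (- u) = fejer L u"
proof -
  have "(\<Sum>j<L. ee (real j * (- u))) = cnj (\<Sum>j<L. ee (real j * u))"
    by (simp add: cnj_sum ee_minus)
  then show ?thesis by (simp only: fejer_def complex_mod_cnj)
qed

lemma fejer_add_int: "fejer L (u + of_int k) = fejer L u"
proof -
  have "ee (real j * (u + of_int k)) = ee (real j * u)" for j
    using ee_int [of "int j * k"] by (simp add: distrib_left ee_add)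
  then show ?thesis by (simp add: fejer_def)
qed

lemma fejer_le:
  assumes "0 < d" "d \<le> u" "u \<le> 1 - d"
  shows "fejer L u \<le> 1 / (4 * real L * d\<^sup>2)"
proof -
  have "fejer L u \<le> (1 / (2 * d))\<^sup>2 / real L"
    unfolding fejer_def by (intro divide_right_mono power_mono norm_sum_ee_le assms) auto
  then show ?thesis by (simp add: power_divide power_mult_distrib mult_ac)
qed

text \<open>Translation by the multiples of 1/L averages out every frequency i - j with 0 < |i - j|
  < L; only the L diagonal terms remain.\<close>

lemma sum_fejer_grid:
  assumes L: "0 < L"
  shows "(\<Sum>a<L. fejer L (t - real a / real L)) = real L"
proof -
  have geom: "(\<Sum>a<L. ee ((real i - real j) * (t - real a / real L))) = (if i = j then of_nat L else 0)"
    if ij: "i < L" "j < L" for i j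
  proof (cases "i = j")
    case False
    \<comment> \<open>e(u) is an L-th root of unity different from 1, so its powers sum to
      0.\<close>
    define u where "u = - ((real i - real j) / real L)"
    have "\<bar>u\<bar> < 1" "u \<noteq> 0" using ij False L by (auto simp: u_def field_simps)
    then have "sin (pi * u) \<noteq> 0"
      using sin_gt_zero [of "pi * \<bar>u\<bar>"] by (auto simp: abs_if split: if_splits)
    then have ne: "ee u \<noteq> 1" using norm_one_minus_ee [of u] by auto
    have "real L * u = of_int (int j - int i)" using L by (simp add: u_def)
    then have "ee u ^ L = 1" by (simp only: ee_power ee_int)
    then have z: "(\<Sum>a<L. ee u ^ a) = 0" using ne by (simp add: sum_gp_strict)
    have "ee ((real i - real j) * (t - real a / real L)) = ee ((real i - real j) * t) * ee u ^ a" for a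
      unfolding ee_power ee_add [symmetric] by (simp add: u_def algebra_simps)
    then have "(\<Sum>a<L. ee ((real i - real j) * (t - real a / real L)))
        = ee ((real i - real j) * t) * (\<Sum>a<L. ee u ^ a)"
      by (simp add: sum_distrib_left)
    with z False show ?thesis by simp
  qed simp
  have "complex_of_real (\<Sum>a<L. fejer L (t - real a / real L))
      = (\<Sum>a<L. \<Sum>i<L. \<Sum>j<L. ee ((real i - real j) * (t - real a / real L))) / of_nat L"
    by (simp add: fejer_expand sum_divide_distrib)
  also have "(\<Sum>a<L. \<Sum>i<L. \<Sum>j<L. ee ((real i - real j) * (t - real a / real L)))
      = (\<Sum>i<L. \<Sum>a<L. \<Sum>j<L. ee ((real i - real j) * (t - real a / real L)))"
    by (rule sum.swap)
  also have "\<dots> = (\<Sum>i<L. \<Sum>j<L. \<Sum>a<L. ee ((real i - real j) * (t - real a / real L)))"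
    by (intro sum.cong refl sum.swap)
  also have "\<dots> = (\<Sum>i<L. \<Sum>j<L. if i = j then of_nat L else 0)"
    by (intro sum.cong refl geom) auto
  also have "\<dots> / of_nat L = complex_of_real (real L)"
    using L by simp
  finally show ?thesis by (simp only: of_real_eq_iff)
qed

text \<open>In the expanded kernel the diagonal pairs give the total weight and each of the L^2
  pairs contributes at most \<sigma>, before division by L. Centring at c only inserts factors of
  modulus 1, and negative frequencies are conjugates of positive ones.\<close>

lemma sum_fejer_weighted:
  fixes w t :: "'a \<Rightarrow> real"
  assumes w: "\<And>n. n \<in> R \<Longrightarrow> 0 \<le> w n" and L: "0 < L" and sg: "0 \<le> \<sigma>"
    and exp: "\<And>h. 1 \<le> h \<Longrightarrow> h < L \<Longrightarrow> norm (\<Sum>n\<in>R. complex_of_real (w n) * ee (real h * t n)) \<le> \<sigma>"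
  shows "(\<Sum>n\<in>R. w n * fejer L (t n - c)) \<le> sum w R + real L * \<sigma>"
proof -
  define T where "T i j = (\<Sum>n\<in>R. complex_of_real (w n) * ee ((real i - real j) * t n))" for i j
  have Tge: "norm (T i j) \<le> (if i = j then sum w R else \<sigma>)" if "j \<le> i" "i < L" for i j
  proof (cases "i = j")
    case True
    then have "T i j = complex_of_real (sum w R)" by (simp add: T_def)
    then show ?thesis using True w by (simp only: norm_of_real) (simp add: sum_nonneg)
  next
    case False
    have "real i - real j = real (i - j)" using that by simp
    then show ?thesis using exp [of "i - j"] False that by (simp add: T_def)
  qed
  have T: "norm (T i j) \<le> (if i = j then sum w R else 0) + \<sigma>" if "i < L" "j < L" for i j
  proof (cases "j \<le> i")
    case True
    then show ?thesis using Tge [of j i] that sg by auto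
  next
    case False
    have "cnj (ee ((real j - real i) * t n)) = ee ((real i - real j) * t n)" for n
      by (simp flip: ee_minus add: algebra_simps)
    then have "T i j = cnj (T j i)"
      by (simp add: T_def cnj_sum)
    then show ?thesis using Tge [of i j] that False sg by auto
  qed
  have "complex_of_real (\<Sum>n\<in>R. w n * fejer L (t n - c))
      = (\<Sum>n\<in>R. \<Sum>i<L. \<Sum>j<L. complex_of_real (w n) * ee ((real i - real j) * (t n - c))) / of_nat L"
    by (simp add: fejer_expand sum_divide_distrib sum_distrib_left)
  also have "(\<Sum>n\<in>R. \<Sum>i<L. \<Sum>j<L. complex_of_real (w n) * ee ((real i - real j) * (t n - c)))
      = (\<Sum>i<L. \<Sum>n\<in>R. \<Sum>j<L. complex_of_real (w n) * ee ((real i - real j) * (t n - c)))"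
    by (rule sum.swap)
  also have "\<dots> = (\<Sum>i<L. \<Sum>j<L. \<Sum>n\<in>R. complex_of_real (w n) * ee ((real i - real j) * (t n - c)))"
    by (intro sum.cong refl sum.swap)
  also have "\<dots> = (\<Sum>i<L. \<Sum>j<L. cnj (ee ((real i - real j) * c)) * T i j)"
    unfolding T_def sum_distrib_left
    by (intro sum.cong refl) (simp add: right_diff_distrib ee_diff)
  finally have "norm (complex_of_real (\<Sum>n\<in>R. w n * fejer L (t n - c)))
      = norm (\<Sum>i<L. \<Sum>j<L. cnj (ee ((real i - real j) * c)) * T i j) / real L"
    by (simp only: norm_divide norm_of_nat)
  also have "norm (\<Sum>i<L. \<Sum>j<L. cnj (ee ((real i - real j) * c)) * T i j)
      \<le> (\<Sum>i<L. \<Sum>j<L. (if i = j then sum w R else 0) + \<sigma>)"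
    using T by (intro order_trans [OF norm_sum] sum_mono) (auto simp: norm_mult)
  also have "\<dots> = real L * sum w R + real L * real L * \<sigma>"
    by (simp add: sum.distrib algebra_simps)
  finally have "norm (complex_of_real (\<Sum>n\<in>R. w n * fejer L (t n - c)))
      \<le> (real L * sum w R + real L * real L * \<sigma>) / real L"
    by (simp add: divide_right_mono)
  also have "\<dots> = sum w R + real L * \<sigma>" using L by (simp add: field_simps)
  finally show ?thesis unfolding norm_of_real by linarith
qed

text \<open>
  An interval is majorised by the average of the Fejer kernels centred at the points \<open>a / L\<close> of a
  slightly larger interval; averaged over all \<open>a < L\<close>, these kernels sum to a constant.
\<close>

lemma equidistribution_upper:
  fixes w t :: "'a \<Rightarrow> real" and s \<rho> \<sigma> :: real
  assumes fin: "finite R" and w: "\<And>n. n \<in> R \<Longrightarrow> 0 \<le> w n" and L: "0 < L" and sg: "0 \<le> \<sigma>"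
    and s: "0 < s" "0 \<le> \<rho>"
    and exp: "\<And>h. 1 \<le> h \<Longrightarrow> h < L \<Longrightarrow> norm (\<Sum>n\<in>R. complex_of_real (w n) * ee (real h * t n)) \<le> \<sigma>"
  shows "(1 - real L / (4 * s\<^sup>2)) * (\<Sum>n\<in>{n\<in>R. frac (t n) < \<rho>}. w n)
           \<le> (\<rho> + (2 * s + 1) / real L) * sum w R + real L * \<sigma>"
proof -
  \<comment> \<open>Indices of the grid points within s/L of [0, \<rho>] modulo 1; the second
    alternative collects those just to the left of 0.\<close>
  define J where "J = {a. a < L \<and> (real a \<le> \<rho> * real L + s \<or> real L - s \<le> real a)}"
  define G where "G = {n\<in>R. frac (t n) < \<rho>}"
  have J: "finite J" "J \<subseteq> {..<L}" by (auto simp: J_def)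
  have cardJ: "real (card J) \<le> \<rho> * real L + 2 * s + 1"
  proof -
    have "J \<subseteq> {..nat \<lfloor>\<rho> * real L + s\<rfloor>} \<union> {nat \<lceil>real L - s\<rceil>..<L}"
        by (auto simp: J_def le_nat_floor)
    then have "card J \<le> card ({..nat \<lfloor>\<rho> * real L + s\<rfloor>} \<union> {nat \<lceil>real L - s\<rceil>..<L})"
      by (intro card_mono) auto
    also have "\<dots> \<le> Suc (nat \<lfloor>\<rho> * real L + s\<rfloor>) + (L - nat \<lceil>real L - s\<rceil>)"
      by (rule order_trans [OF card_Un_le]) simp
    finally have "real (card J) \<le> real (Suc (nat \<lfloor>\<rho> * real L + s\<rfloor>)) + real (L - nat \<lceil>real L - s\<rceil>)"
      by linarith
    moreover have "real (nat \<lfloor>\<rho> * real L + s\<rfloor>) \<le> \<rho> * real L + s" using s by simp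
    moreover have "real (L - nat \<lceil>real L - s\<rceil>) \<le> s"
      using s by (cases "nat \<lceil>real L - s\<rceil> \<le> L") (auto simp: of_nat_diff, linarith)
    ultimately show ?thesis by simp
  qed
  have cardJL: "real (card J) / real L \<le> 1"
    using card_mono [OF _ J(2)] L by simp
  \<comment> \<open>A grid point outside \<open>J\<close> is at least s/L away from t(n) modulo 1,
    where the kernel is at most 1 / (4L (s/L)^2).\<close>
  have far: "fejer L (t n - real a / real L) \<le> real L / (4 * s\<^sup>2)"
    if n: "n \<in> G" and a: "a < L" "a \<notin> J" for n a
  proof -
    have f: "0 \<le> frac (t n)" "frac (t n) < \<rho>" using n by (auto simp: G_def)
    have a': "\<rho> * real L + s < real a" "real a < real L - s" using a by (auto simp: J_def)
    have "t n - real a / real L = - (real a / real L - frac (t n)) + of_int \<lfloor>t n\<rfloor>"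
      by (simp add: frac_def)
    then have "fejer L (t n - real a / real L) = fejer L (real a / real L - frac (t n))"
      by (simp only: fejer_add_int fejer_minus)
    also have "\<dots> \<le> 1 / (4 * real L * (s / real L)\<^sup>2)"
    proof (rule fejer_le)
      have "\<rho> + s / real L = (\<rho> * real L + s) / real L" using L by (simp add: add_divide_distrib)
      also have "\<dots> \<le> real a / real L" using a' by (intro divide_right_mono) auto
      finally have "\<rho> + s / real L \<le> real a / real L" .
      then show "s / real L \<le> real a / real L - frac (t n)" using f by linarith
      have "real a / real L \<le> 1 - s / real L" using a' L by (simp add: field_simps)
      then show "real a / real L - frac (t n) \<le> 1 - s / real L" using f by linarith
    qed (use s L in auto)
    also have "\<dots> = real L / (4 * s\<^sup>2)"
      using s L by (simp add: field_simps power2_eq_square)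
    finally show ?thesis .
  qed
  \<comment> \<open>All L kernels sum to L and the far ones to at most L times the previous bound,
    so those in \<open>J\<close> carry the rest.\<close>
  have good: "real L * (1 - real L / (4 * s\<^sup>2)) \<le> (\<Sum>a\<in>J. fejer L (t n - real a / real L))" if n: "n \<in> G" for n
  proof -
    have "real L = (\<Sum>a\<in>{..<L} - J. fejer L (t n - real a / real L)) + (\<Sum>a\<in>J. fejer L (t n - real a / real L))"
      using sum.subset_diff [OF J(2), of "\<lambda>a. fejer L (t n - real a / real L)"] sum_fejer_grid [OF L, of "t n"]
      by simp
    moreover have "(\<Sum>a\<in>{..<L} - J. fejer L (t n - real a / real L)) \<le> (\<Sum>a\<in>{..<L} - J. real L / (4 * s\<^sup>2))"
      using far [OF n] by (intro sum_mono) auto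
    moreover have "\<dots> \<le> (\<Sum>a<L. real L / (4 * s\<^sup>2))"
      by (intro sum_mono2) auto
    ultimately show ?thesis by (simp add: algebra_simps)
  qed
  have "real L * (1 - real L / (4 * s\<^sup>2)) * (\<Sum>n\<in>G. w n)
      = (\<Sum>n\<in>G. w n * (real L * (1 - real L / (4 * s\<^sup>2))))"
    unfolding sum_distrib_right [symmetric] by (rule mult.commute)
  also have "\<dots> \<le> (\<Sum>n\<in>G. w n * (\<Sum>a\<in>J. fejer L (t n - real a / real L)))"
    by (intro sum_mono mult_left_mono good w) (auto simp: G_def)
  \<comment> \<open>Nonnegativity of the kernel allows passing from \<open>G\<close> to all of
    R.\<close>
  also have "\<dots> \<le> (\<Sum>n\<in>R. w n * (\<Sum>a\<in>J. fejer L (t n - real a / real L)))"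
    using fin w by (intro sum_mono2) (auto simp: G_def intro!: mult_nonneg_nonneg sum_nonneg fejer_nonneg)
  also have "\<dots> = (\<Sum>a\<in>J. \<Sum>n\<in>R. w n * fejer L (t n - real a / real L))"
    unfolding sum_distrib_left by (rule sum.swap)
  also have "\<dots> \<le> (\<Sum>a\<in>J. sum w R + real L * \<sigma>)"
    by (intro sum_mono sum_fejer_weighted w L sg exp)
  finally have "real L * ((1 - real L / (4 * s\<^sup>2)) * (\<Sum>n\<in>G. w n)) \<le> real (card J) * (sum w R + real L * \<sigma>)"
    by (simp add: mult.assoc)
  then have "(1 - real L / (4 * s\<^sup>2)) * (\<Sum>n\<in>G. w n) \<le> real (card J) / real L * (sum w R + real L * \<sigma>)"
    using L by (simp add: field_simps)
  also have "\<dots> = real (card J) / real L * sum w R + real (card J) / real L * (real L * \<sigma>)"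
    by (simp add: distrib_left)
  also have "\<dots> \<le> (\<rho> + (2 * s + 1) / real L) * sum w R + 1 * (real L * \<sigma>)"
  proof (intro add_mono mult_right_mono cardJL)
    show "real (card J) / real L \<le> \<rho> + (2 * s + 1) / real L"
      using cardJ L by (simp add: field_simps)
  qed (use w sg in \<open>auto intro: sum_nonneg\<close>)
  finally show ?thesis by (simp add: G_def)
qed

text \<open>With m = [u] one has [u/q] = m div q, so the condition on the fractional part reads u <
  q (m div q) + 1, which forces m mod q = 0.\<close>

lemma dvd_floor_iff_frac:
  fixes u :: real
  assumes "0 \<le> u" "1 \<le> q"
  shows "q dvd nat \<lfloor>u\<rfloor> \<longleftrightarrow> frac (u / real q) < 1 / real q"
proof -
  define m where "m = \<lfloor>u\<rfloor>"
  have m: "0 \<le> m" "of_int m \<le> u" "u < of_int m + 1" using assms by (auto simp: m_def)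
  have fl: "\<lfloor>u / real q\<rfloor> = m div int q"
    using floor_divide_real_eq_div [of "int q" u] by (simp add: m_def)
  have "frac (u / real q) < 1 / real q \<longleftrightarrow> u / real q < of_int (m div int q) + 1 / real q"
    by (simp add: frac_def fl) linarith
  also have "\<dots> \<longleftrightarrow> u < real_of_int (int q * (m div int q)) + 1"
    using assms by (simp add: field_simps)
  also have "\<dots> \<longleftrightarrow> m mod int q = 0"
  proof
    assume "u < real_of_int (int q * (m div int q)) + 1"
    then have "real_of_int m < real_of_int (int q * (m div int q) + 1)" using m by simp
    then have "m < int q * (m div int q) + 1" by (simp only: of_int_less_iff)
    moreover have "int q * (m div int q) + m mod int q = m" by simp
    moreover have "0 \<le> m mod int q" using assms by simp
    ultimately show "m mod int q = 0" by linarith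
  next
    assume "m mod int q = 0"
    then have "int q * (m div int q) = m" by auto
    then show "u < real_of_int (int q * (m div int q)) + 1" using m by simp
  qed
  also have "\<dots> \<longleftrightarrow> int q dvd m" by (simp add: dvd_eq_mod_eq_0)
  also have "\<dots> \<longleftrightarrow> q dvd nat m" using m by (metis int_dvd_int_iff nat_0_le)
  finally show ?thesis by (simp add: m_def)
qed

section \<open>The logarithmic weight of the n for which q divides [x/n]\<close>

definition bulk_mass :: "real \<Rightarrow> real" where
  "bulk_mass x = (\<Sum>n\<in>bulk x. 1 / real n)"

definition multiples_mass :: "real \<Rightarrow> nat \<Rightarrow> real" where
  "multiples_mass x q = (\<Sum>n\<in>{n\<in>bulk x. q dvd nat \<lfloor>x / real n\<rfloor>}. 1 / real n)"

lemma multiples_mass_nonneg: "0 \<le> multiples_mass x q"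
  by (simp add: multiples_mass_def sum_nonneg)

lemma multiples_mass_le: "multiples_mass x q \<le> bulk_mass x"
  unfolding multiples_mass_def bulk_mass_def by (intro sum_mono2) auto

lemma bulk_mass_nonneg: "0 \<le> bulk_mass x"
  by (simp add: bulk_mass_def sum_nonneg)

lemma powr_range_memberD:
  assumes "1 \<le> x" "\<beta> \<le> 1" "0 \<le> \<alpha>" "n \<in> powr_range \<alpha> \<beta> x"
  shows "1 \<le> n" "real n \<le> x"
proof -
  have "x powr 0 \<le> x powr \<alpha>" "x powr \<beta> \<le> x powr 1"
    using assms by (intro powr_mono; simp)+
  then have "1 \<le> x powr \<alpha>" "x powr \<beta> \<le> x" using assms by auto
  moreover have "nat \<lceil>x powr \<alpha>\<rceil> \<le> n" "n < nat \<lfloor>x powr \<beta>\<rfloor>"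
    using assms by (auto simp: powr_range_def)
  ultimately show "1 \<le> n" "real n \<le> x" by linarith+
qed

lemma bulk_memberD:
  assumes "1 \<le> x" "n \<in> bulk x"
  shows "1 \<le> n" "real n \<le> x"
  using assms by (auto simp: bulk_def dest: powr_range_memberD [rotated -1])

text \<open>A lower bound for the multiples is replaced by an upper bound for the rest: after a
  shift by 1/q, which leaves the moduli of the exponential sums unchanged, the complementary
  fractional parts fill an initial interval of length 1 - 1/q. The bounds are uniform in q, L and s
  so that these can be chosen differently for fixed and for growing moduli.\<close>

lemma multiples_mass_bounds:
  "\<forall>\<^sub>F x in at_top. \<forall>q L s. 1 \<le> q \<and> real q \<le> ln x ^ 2 \<and> 0 < L \<and> real L \<le> ln x ^ 4 \<and> 0 < (s::real) \<longrightarrow>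
     (1 - real L / (4 * s\<^sup>2)) * multiples_mass x q
       \<le> (1 / real q + (2 * s + 1) / real L) * bulk_mass x + real L / ln x ^ 20 \<and>
     (1 - real L / (4 * s\<^sup>2)) * (bulk_mass x - multiples_mass x q)
       \<le> (1 - 1 / real q + (2 * s + 1) / real L) * bulk_mass x + real L / ln x ^ 20"
proof -
  have "\<forall>\<^sub>F x::real in at_top. x powr (1 - 1/1000) \<le> x / ln x ^ 2" by real_asymp
  moreover have "\<forall>\<^sub>F x::real in at_top. ln x ^ 4 * x \<le> x powr (1 + 1/1000)" by real_asymp
  ultimately show ?thesis
    using weighted_exp_sum_bulk eventually_gt_at_top [of 1]
  proof eventually_elim
    case (elim x)
    have x: "1 < x" "ln x > 0" using elim by auto
    show ?case
    proof (intro allI impI)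
      fix q L :: nat and s :: real
      assume "1 \<le> q \<and> real q \<le> ln x ^ 2 \<and> 0 < L \<and> real L \<le> ln x ^ 4 \<and> 0 < s"
      then have q: "1 \<le> q" "real q \<le> ln x ^ 2" and L: "0 < L" "real L \<le> ln x ^ 4" and s: "0 < s" by auto
      define t where "t n = x / (real q * real n)" for n
      have exp: "norm (\<Sum>n\<in>bulk x. complex_of_real (1 / real n) * ee (real h * t n)) \<le> 1 / ln x ^ 20"
        if h: "1 \<le> h" "h < L" for h
      proof -
        define y where "y = real h * x / real q"
        have "x / ln x ^ 2 \<le> x / real q"
          using q x by (intro divide_left_mono) auto
        also have "\<dots> = 1 * x / real q" by simp
        also have "\<dots> \<le> y"
          unfolding y_def using h q x by (intro divide_right_mono mult_right_mono) auto
        finally have y1: "x powr (1 - 1/1000) \<le> y" using elim by linarith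
        have "y \<le> (real h * x) / 1"
          unfolding y_def using h q x by (intro divide_left_mono) auto
        also have "\<dots> \<le> ln x ^ 4 * x" using h L x by (simp add: mult_right_mono)
        finally have y2: "y \<le> x powr (1 + 1/1000)" using elim by linarith
        have "(\<Sum>n\<in>bulk x. complex_of_real (1 / real n) * ee (real h * t n))
            = (\<Sum>n\<in>bulk x. ee (y / real n) / of_nat n)"
          by (intro sum.cong refl) (simp add: t_def y_def)
        then show ?thesis using elim y1 y2 by simp
      qed
      have iff: "q dvd nat \<lfloor>x / real n\<rfloor> \<longleftrightarrow> frac (t n) < 1 / real q" if "n \<in> bulk x" for n
        using dvd_floor_iff_frac [of "x / real n" q] q x by (simp add: t_def mult.commute)
      have M: "multiples_mass x q = (\<Sum>n\<in>{n\<in>bulk x. frac (t n) < 1 / real q}. 1 / real n)"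
        unfolding multiples_mass_def by (intro sum.cong) (auto simp: iff)
      have 1: "(1 - real L / (4 * s\<^sup>2)) * multiples_mass x q
          \<le> (1 / real q + (2 * s + 1) / real L) * bulk_mass x + real L * (1 / ln x ^ 20)"
        unfolding M bulk_mass_def using x L s by (intro equidistribution_upper exp) auto
      have exp': "norm (\<Sum>n\<in>bulk x. complex_of_real (1 / real n) * ee (real h * (t n - 1 / real q))) \<le> 1 / ln x ^ 20"
        if h: "1 \<le> h" "h < L" for h
      proof -
        have "(\<Sum>n\<in>bulk x. complex_of_real (1 / real n) * ee (real h * (t n - 1 / real q)))
           = cnj (ee (real h * (1 / real q))) * (\<Sum>n\<in>bulk x. complex_of_real (1 / real n) * ee (real h * t n))"
          unfolding sum_distrib_left by (intro sum.cong refl) (simp add: right_diff_distrib ee_diff)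
        then have "norm (\<Sum>n\<in>bulk x. complex_of_real (1 / real n) * ee (real h * (t n - 1 / real q)))
           = norm (\<Sum>n\<in>bulk x. complex_of_real (1 / real n) * ee (real h * t n))"
          by (simp only: norm_mult complex_mod_cnj norm_ee mult_1_left)
        then show ?thesis using exp [OF h] by simp
      qed
      have compl: "frac (v - 1 / real q) < 1 - 1 / real q" if "\<not> frac v < 1 / real q" for v
      proof -
        have "0 \<le> frac v - 1 / real q" "frac v - 1 / real q < 1"
          using that frac_lt_1 [of v] zero_le_divide_1_iff [of "real q"] by linarith+
        then have "frac (v - 1 / real q) = frac v - 1 / real q"
          by (subst frac_unique_iff) (auto simp: frac_def Ints_def)
        then show ?thesis using frac_lt_1 [of v] by simp
      qed
      have "bulk_mass x - multiples_mass x q = (\<Sum>n\<in>{n\<in>bulk x. \<not> frac (t n) < 1 / real q}. 1 / real n)"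
      proof -
        have "bulk x = {n\<in>bulk x. frac (t n) < 1 / real q} \<union> {n\<in>bulk x. \<not> frac (t n) < 1 / real q}" by auto
        then have "bulk_mass x = multiples_mass x q + (\<Sum>n\<in>{n\<in>bulk x. \<not> frac (t n) < 1 / real q}. 1 / real n)"
          unfolding bulk_mass_def M by (subst sum.union_disjoint [symmetric]) auto
        then show ?thesis by simp
      qed
      also have "\<dots> \<le> (\<Sum>n\<in>{n\<in>bulk x. frac (t n - 1 / real q) < 1 - 1 / real q}. 1 / real n)"
        using compl by (intro sum_mono2) auto
      finally have le: "bulk_mass x - multiples_mass x q
          \<le> (\<Sum>n\<in>{n\<in>bulk x. frac (t n - 1 / real q) < 1 - 1 / real q}. 1 / real n)" .
      have 2: "(1 - real L / (4 * s\<^sup>2)) * (\<Sum>n\<in>{n\<in>bulk x. frac (t n - 1 / real q) < 1 - 1 / real q}. 1 / real n)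
          \<le> (1 - 1 / real q + (2 * s + 1) / real L) * bulk_mass x + real L * (1 / ln x ^ 20)"
        unfolding bulk_mass_def using x L s q by (intro equidistribution_upper exp') auto
      have 3: "(1 - real L / (4 * s\<^sup>2)) * (bulk_mass x - multiples_mass x q)
          \<le> (1 - 1 / real q + (2 * s + 1) / real L) * bulk_mass x + real L * (1 / ln x ^ 20)"
      \<comment> \<open>Only a nonnegative coefficient may multiply \<open>le\<close>; for a
        negative one the left side is at most 0.\<close>
      proof (cases "0 \<le> 1 - real L / (4 * s\<^sup>2)")
        case True
        from mult_left_mono [OF le this] 2 show ?thesis by linarith
      next
        case False
        have "(1 - real L / (4 * s\<^sup>2)) * (bulk_mass x - multiples_mass x q) \<le> 0"
          using False multiples_mass_le [of x q] by (intro mult_nonpos_nonneg) auto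
        also have "0 \<le> (1 - 1 / real q + (2 * s + 1) / real L) * bulk_mass x + real L * (1 / ln x ^ 20)"
          using q s L x bulk_mass_nonneg [of x] by (intro add_nonneg_nonneg mult_nonneg_nonneg) auto
        finally show ?thesis .
      qed
      show "(1 - real L / (4 * s\<^sup>2)) * multiples_mass x q
          \<le> (1 / real q + (2 * s + 1) / real L) * bulk_mass x + real L / ln x ^ 20 \<and>
        (1 - real L / (4 * s\<^sup>2)) * (bulk_mass x - multiples_mass x q)
          \<le> (1 - 1 / real q + (2 * s + 1) / real L) * bulk_mass x + real L / ln x ^ 20"
        using 1 3 by simp
    qed
  qed
qed

lemma powr_range_mass_ge:
  assumes x: "1 \<le> x" and al: "0 \<le> \<alpha>" and le: "x powr \<alpha> + 2 \<le> x powr \<beta>"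
  shows "ln (x powr \<beta> - 1) - ln (x powr \<alpha> + 1) \<le> (\<Sum>n\<in>powr_range \<alpha> \<beta> x. 1 / real n)"
proof -
  define A where "A = nat \<lceil>x powr \<alpha>\<rceil>"
  define v where "v = nat \<lfloor>x powr \<beta>\<rfloor>"
  have "x powr 0 \<le> x powr \<alpha>" using x al by (intro powr_mono) auto
  then have a1: "1 \<le> x powr \<alpha>" using x by simp
  have A: "x powr \<alpha> \<le> real A" "real A \<le> x powr \<alpha> + 1" unfolding A_def using a1 by linarith+
  have v: "x powr \<beta> - 1 \<le> real v" unfolding v_def using a1 le by linarith
  have Av: "1 \<le> A" "A \<le> v" using A v a1 le by linarith+
  have "ln (x powr \<beta> - 1) \<le> ln (real v)" using v a1 le by (subst ln_le_cancel_iff) auto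
  moreover have "ln (real A) \<le> ln (x powr \<alpha> + 1)" using A a1 by (subst ln_le_cancel_iff) auto
  moreover have "ln (real v) - ln (real A) \<le> (\<Sum>n = A..<v. 1 / real n)"
    using Av by (intro sum_inverse_bounds) auto
  ultimately show ?thesis by (simp add: powr_range_def A_def v_def)
qed

text \<open>The exponent ranges have lengths 48/100, 15/100 and 7/100, with sum 7/10; the constant 1
  pays for the rounding of the endpoints.\<close>

lemma bulk_mass_ge: "\<forall>\<^sub>F x in at_top. 7 / 10 * ln x - 1 \<le> bulk_mass x"
proof -
  have "\<forall>\<^sub>F x::real in at_top. x powr (51/100) + 2 \<le> x powr (99/100)" by real_asymp
  moreover have "\<forall>\<^sub>F x::real in at_top. x powr (34/100) + 2 \<le> x powr (49/100)" by real_asymp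
  moreover have "\<forall>\<^sub>F x::real in at_top. x powr (26/100) + 2 \<le> x powr (33/100)" by real_asymp
  moreover have "\<forall>\<^sub>F x::real in at_top. 48/100 * ln x - 1/3 \<le> ln (x powr (99/100) - 1) - ln (x powr (51/100) + 1)"
    by real_asymp
  moreover have "\<forall>\<^sub>F x::real in at_top. 15/100 * ln x - 1/3 \<le> ln (x powr (49/100) - 1) - ln (x powr (34/100) + 1)"
    by real_asymp
  moreover have "\<forall>\<^sub>F x::real in at_top. 7/100 * ln x - 1/3 \<le> ln (x powr (33/100) - 1) - ln (x powr (26/100) + 1)"
    by real_asymp
  ultimately show ?thesis
    using eventually_ge_at_top [of 1]
  proof eventually_elim
    case (elim x)
    have "bulk_mass x \<ge> (48/100 * ln x - 1/3) + ((15/100 * ln x - 1/3) + (7/100 * ln x - 1/3))"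
      unfolding bulk_mass_def sum_bulk [OF elim(7)]
      by (intro add_mono order_trans [OF elim(4)] order_trans [OF elim(5)] order_trans [OF elim(6)]
            powr_range_mass_ge elim) auto
    then show ?case by simp
  qed
qed

text \<open>For a large constant m, the choice L = m^4 and s = m^3 makes both L/(4s^2) and (2s+1)/L
  at most a multiple of 1/m.\<close>

lemma multiples_mass_asymp:
  assumes q: "1 \<le> q" and ep: "0 < \<epsilon>"
  shows "\<forall>\<^sub>F x in at_top. \<bar>multiples_mass x q - bulk_mass x / real q\<bar> \<le> \<epsilon> * bulk_mass x"
proof -
  \<comment> \<open>The 5 is 3 + 1 + 1: from (2s+1)/L, from L/(4s^2) and from the exponential
    sums.\<close>
  obtain m :: nat where m: "5 / \<epsilon> < real m" using reals_Archimedean2 by blast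
  have "0 < 5 / \<epsilon>" using ep by simp
  then have m1: "1 \<le> real m" "0 < m" using m by (cases m; simp)+
  have m5: "5 / real m \<le> \<epsilon>" using m m1 ep by (simp add: field_simps)
  have "\<forall>\<^sub>F x::real in at_top. real q \<le> ln x ^ 2" by real_asymp
  moreover have "\<forall>\<^sub>F x::real in at_top. real (m ^ 4) \<le> ln x ^ 4" by real_asymp
  moreover have "\<forall>\<^sub>F x::real in at_top. real (m ^ 4) / ln x ^ 20 \<le> 1 / real m" using m1 by real_asymp
  moreover have "\<forall>\<^sub>F x::real in at_top. 1 \<le> 7 / 10 * ln x - 1" by real_asymp
  ultimately show ?thesis
    using multiples_mass_bounds bulk_mass_ge
  proof eventually_elim
    case (elim x)
    define N where "N = multiples_mass x q"
    define W where "W = bulk_mass x"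
    have W: "1 \<le> W" "0 \<le> N" "N \<le> W"
      using elim multiples_mass_le multiples_mass_nonneg by (auto simp: W_def N_def)
    define d where "d = real (m ^ 4) / (4 * (real (m ^ 3))\<^sup>2)"
    have d: "d \<le> 1 / real m" "(2 * real (m ^ 3) + 1) / real (m ^ 4) \<le> 3 / real m"
    proof -
      have "d = 1 / (4 * real m * real m)" using m1 by (simp add: d_def field_simps power_numeral_reduce)
      also have "\<dots> \<le> 1 / real m" using m1 by (intro divide_left_mono) auto
      finally show "d \<le> 1 / real m" .
      have "1 \<le> real (m ^ 3)" using m1 by simp
      then have "(2 * real (m ^ 3) + 1) / real (m ^ 4) \<le> (3 * real (m ^ 3)) / real (m ^ 4)"
        by (intro divide_right_mono) auto
      also have "\<dots> = 3 / real m" using m1 by (simp add: field_simps power_numeral_reduce)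
      finally show "(2 * real (m ^ 3) + 1) / real (m ^ 4) \<le> 3 / real m" .
    qed
    have mm: "0 < m ^ 4" "0 < real (m ^ 3)" using m1 by auto
    have b: "(1 - d) * N \<le> (1 / real q + (2 * real (m ^ 3) + 1) / real (m ^ 4)) * W + real (m ^ 4) / ln x ^ 20"
       "(1 - d) * (W - N) \<le> (1 - 1 / real q + (2 * real (m ^ 3) + 1) / real (m ^ 4)) * W + real (m ^ 4) / ln x ^ 20"
      using elim(5) [rule_format, of q "m ^ 4" "real (m ^ 3)"] elim(1,2) q mm
      unfolding N_def W_def d_def by blast+
    have e: "((2 * real (m ^ 3) + 1) / real (m ^ 4)) * W \<le> 3 / real m * W"
        "real (m ^ 4) / ln x ^ 20 \<le> 1 / real m * W" "d * N \<le> 1 / real m * W" "d * (W - N) \<le> 1 / real m * W"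
    proof -
      show "((2 * real (m ^ 3) + 1) / real (m ^ 4)) * W \<le> 3 / real m * W"
        using d W by (intro mult_right_mono) auto
      have "1 / real m * 1 \<le> 1 / real m * W" using W by (intro mult_left_mono) auto
      then show "real (m ^ 4) / ln x ^ 20 \<le> 1 / real m * W" using elim(3) by linarith
      show "d * N \<le> 1 / real m * W" "d * (W - N) \<le> 1 / real m * W"
        using d W by (intro mult_mono; simp)+
    qed
    have "1 / real m * W = W / real m" "3 / real m * W = 3 * (W / real m)" by simp_all
    then have "\<bar>N - W / real q\<bar> \<le> 5 * (W / real m)"
      using b e by (simp add: left_diff_distrib distrib_right)
    also have "\<dots> = 5 / real m * W" by simp
    also have "\<dots> \<le> \<epsilon> * W" using m5 W by (intro mult_right_mono) auto
    finally show ?case by (simp add: N_def W_def)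
  qed
qed

text \<open>The choice L = p^2 and s = p makes the left coefficient 3/4 and all main terms of order
  1/p. For moduli growing with x this gives an upper bound of the right order, enough to discard
  large prime factors.\<close>

lemma multiples_mass_uniform:
  "\<forall>\<^sub>F x in at_top. \<forall>p. 2 \<le> p \<and> real p \<le> ln x ^ 2 \<longrightarrow>
     multiples_mass x p \<le> 6 * bulk_mass x / real p + 1 / ln x ^ 10"
proof -
  have "\<forall>\<^sub>F x::real in at_top. 4/3 * (ln x ^ 4 / ln x ^ 20) \<le> 1 / ln x ^ 10" by real_asymp
  then show ?thesis
    using multiples_mass_bounds eventually_gt_at_top [of 1]
  proof eventually_elim
    case (elim x)
    show ?case
    proof (intro allI impI)
      fix p :: nat assume p: "2 \<le> p \<and> real p \<le> ln x ^ 2"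
      have lx: "0 < ln x" using elim by simp
      have p4: "real (p\<^sup>2) \<le> ln x ^ 4"
        using power_mono [of "real p" "ln x ^ 2" 2] p by (simp flip: power_mult)
      have "1 \<le> p \<and> real p \<le> ln x ^ 2 \<and> 0 < p\<^sup>2 \<and> real (p\<^sup>2) \<le> ln x ^ 4 \<and> 0 < real p"
        using p p4 by simp
      from elim(2) [rule_format, OF this]
      have "(1 - real (p\<^sup>2) / (4 * (real p)\<^sup>2)) * multiples_mass x p
          \<le> (1 / real p + (2 * real p + 1) / real (p\<^sup>2)) * bulk_mass x + real (p\<^sup>2) / ln x ^ 20" by blast
      also have "1 - real (p\<^sup>2) / (4 * (real p)\<^sup>2) = 3 / 4" using p by simp
      finally have a: "3 / 4 * multiples_mass x p
          \<le> (1 / real p + (2 * real p + 1) / real (p\<^sup>2)) * bulk_mass x + real (p\<^sup>2) / ln x ^ 20" .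
      have "(1 / real p + (2 * real p + 1) / real (p\<^sup>2)) = (3 * real p + 1) / (real p * real p)"
        using p by (simp add: field_simps power2_eq_square)
      also have "\<dots> \<le> (9 / 2 * real p) / (real p * real p)"
        using p by (intro divide_right_mono) auto
      also have "\<dots> = 9 / 2 / real p" using p by simp
      finally have "(1 / real p + (2 * real p + 1) / real (p\<^sup>2)) * bulk_mass x \<le> 9 / 2 / real p * bulk_mass x"
        using bulk_mass_nonneg by (intro mult_right_mono) auto
      moreover have "real (p\<^sup>2) / ln x ^ 20 \<le> ln x ^ 4 / ln x ^ 20"
        using p4 lx by (intro divide_right_mono) auto
      ultimately have "multiples_mass x p \<le> 4/3 * (9 / 2 / real p * bulk_mass x) + 4/3 * (ln x ^ 4 / ln x ^ 20)"
        using a by linarith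
      also have "\<dots> \<le> 6 * bulk_mass x / real p + 1 / ln x ^ 10"
        using elim(1) by (intro add_mono) auto
      finally show "multiples_mass x p \<le> 6 * bulk_mass x / real p + 1 / ln x ^ 10" .
    qed
  qed
qed

section \<open>Totients and the Euler product for \<open>\<zeta>(2)\<close>\<close>

definition primes_upto :: "nat \<Rightarrow> nat set" where
  "primes_upto z = {p. prime p \<and> p \<le> z}"

lemma finite_primes_upto [simp]: "finite (primes_upto z)"
  by (rule finite_subset [of _ "{..z}"]) (auto simp: primes_upto_def)

lemma prod_primes_dvd_iff:
  fixes m :: nat
  assumes "finite S" "\<And>p. p \<in> S \<Longrightarrow> prime p"
  shows "\<Prod>S dvd m \<longleftrightarrow> (\<forall>p\<in>S. p dvd m)"
  using assms
proof (induction S rule: finite_induct)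
  case (insert p S)
  have "coprime p (\<Prod>S)"
    using insert by (intro prod_coprime_right) (metis insert_iff primes_coprime)
  then show ?case using insert by (auto simp: divides_mult dest: dvd_mult_left dvd_mult_right)
qed auto

text \<open>The part of the product formula for \<open>totient m / m\<close> that comes from primes
  up to z. Unlike the full ratio it depends only on divisibility by finitely many fixed
  numbers.\<close>

definition sieved_ratio :: "nat \<Rightarrow> nat \<Rightarrow> real" where
  "sieved_ratio z m = (\<Prod>p\<in>{p\<in>primes_upto z. p dvd m}. 1 - 1 / real p)"

text \<open>Multiplying out gives the sum of \<mu>(d)/d over the squarefree d dividing m with all
  prime factors at most z; d is the product of the subset S.\<close>

lemma sieved_ratio_expand:
  "sieved_ratio z m = (\<Sum>S\<in>Pow (primes_upto z). (\<Prod>p\<in>S. - (1 / real p)) * of_bool (\<Prod>S dvd m))"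
proof -
  have "sieved_ratio z m = (\<Prod>p\<in>primes_upto z. - (1 / real p) * of_bool (p dvd m) + 1)"
    unfolding sieved_ratio_def by (intro prod.mono_neutral_cong_left) auto
  also have "\<dots> = (\<Sum>S\<in>Pow (primes_upto z). (\<Prod>p\<in>S. - (1 / real p) * of_bool (p dvd m)))"
    unfolding prod_add [OF finite_primes_upto] by simp
  also have "\<dots> = (\<Sum>S\<in>Pow (primes_upto z). (\<Prod>p\<in>S. - (1 / real p)) * of_bool (\<Prod>S dvd m))"
  proof (intro sum.cong refl)
    fix S assume S: "S \<in> Pow (primes_upto z)"
    then have fS: "finite S" using finite_subset [OF _ finite_primes_upto] by auto
    have "(\<Prod>p\<in>S. of_bool (p dvd m) :: real) = of_bool (\<forall>p\<in>S. p dvd m)"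
      using fS by (induction S rule: finite_induct) auto
    also have "(\<forall>p\<in>S. p dvd m) \<longleftrightarrow> \<Prod>S dvd m"
      using S fS by (subst prod_primes_dvd_iff) (auto simp: primes_upto_def)
    finally show "(\<Prod>p\<in>S. - (1 / real p) * of_bool (p dvd m)) = (\<Prod>p\<in>S. - (1 / real p)) * of_bool (\<Prod>S dvd m)"
      by (simp only: prod.distrib)
  qed
  finally show ?thesis .
qed

lemma prod_one_minus_ge:
  fixes a :: "'a \<Rightarrow> real"
  assumes "finite A" "\<And>i. i \<in> A \<Longrightarrow> 0 \<le> a i \<and> a i \<le> 1"
  shows "1 - sum a A \<le> (\<Prod>i\<in>A. 1 - a i)"
  using assms
proof (induction A rule: finite_induct)
  case (insert i A)
  have "(\<Prod>i\<in>A. 1 - a i) \<le> 1" using insert by (intro prod_le_1) auto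
  moreover have "0 \<le> a i" using insert by auto
  ultimately have "a i * (\<Prod>i\<in>A. 1 - a i) \<le> a i * 1" by (intro mult_left_mono) auto
  with insert show ?case by (simp add: algebra_simps)
qed auto

text \<open>The primes above z contribute a factor between 1 minus the sum of their reciprocals and
  1.\<close>

lemma totient_sieved_bounds:
  assumes m: "0 < m"
  shows "real (totient m) \<le> real m * sieved_ratio z m"
    and "real m * (sieved_ratio z m - (\<Sum>p\<in>{p\<in>prime_factors m. z < p}. 1 / real p)) \<le> real (totient m)"
proof -
  let ?A = "{p\<in>primes_upto z. p dvd m}" and ?B = "{p\<in>prime_factors m. z < p}"
  have "prime_factors m = ?A \<union> ?B"
    using m by (auto simp: primes_upto_def prime_factors_dvd)
  then have eq: "(\<Prod>p\<in>prime_factors m. 1 - 1 / real p) = sieved_ratio z m * (\<Prod>p\<in>?B. 1 - 1 / real p)"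
    unfolding sieved_ratio_def
    by (subst prod.union_disjoint [symmetric]) (auto simp: primes_upto_def)
  have s: "0 \<le> sieved_ratio z m" "sieved_ratio z m \<le> 1"
    unfolding sieved_ratio_def
    by (auto intro!: prod_nonneg prod_le_1 simp: primes_upto_def dest: prime_gt_0_nat)
  have B: "0 \<le> (\<Prod>p\<in>?B. 1 - 1 / real p)" "(\<Prod>p\<in>?B. 1 - 1 / real p) \<le> 1"
    by (auto intro!: prod_nonneg prod_le_1 dest: prime_gt_0_nat)
  have "sieved_ratio z m * (\<Prod>p\<in>?B. 1 - 1 / real p) \<le> sieved_ratio z m * 1"
    using s B by (intro mult_left_mono) auto
  then show "real (totient m) \<le> real m * sieved_ratio z m"
    unfolding totient_formula2 eq by (intro mult_left_mono) auto
  have "1 - (\<Sum>p\<in>?B. 1 / real p) \<le> (\<Prod>p\<in>?B. 1 - 1 / real p)"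
    by (rule prod_one_minus_ge) (auto dest: prime_gt_0_nat)
  then have "sieved_ratio z m * (1 - (\<Sum>p\<in>?B. 1 / real p)) \<le> sieved_ratio z m * (\<Prod>p\<in>?B. 1 - 1 / real p)"
    using s by (intro mult_left_mono) auto
  moreover have "sieved_ratio z m * (\<Sum>p\<in>?B. 1 / real p) \<le> 1 * (\<Sum>p\<in>?B. 1 / real p)"
    using s by (intro mult_right_mono sum_nonneg) auto
  ultimately have "sieved_ratio z m - (\<Sum>p\<in>?B. 1 / real p) \<le> sieved_ratio z m * (\<Prod>p\<in>?B. 1 - 1 / real p)"
    by (simp add: right_diff_distrib)
  then show "real m * (sieved_ratio z m - (\<Sum>p\<in>?B. 1 / real p)) \<le> real (totient m)"
    unfolding totient_formula2 eq by (intro mult_left_mono) auto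
qed

lemma two_power_card_prime_factors_le:
  assumes "0 < m"
  shows "2 ^ card (prime_factors m) \<le> (m :: nat)"
proof -
  have "2 ^ card (prime_factors m) = (\<Prod>p\<in>prime_factors m. 2 :: nat)" by simp
  also have "\<dots> \<le> \<Prod>(prime_factors m)"
  proof (intro prod_mono conjI)
    show "2 \<le> p" if "p \<in> prime_factors m" for p
      using that in_prime_factors_imp_prime prime_ge_2_nat by blast
  qed auto
  also have "\<dots> \<le> m"
    using assms by (intro dvd_imp_le, subst prod_primes_dvd_iff) auto
  finally show ?thesis .
qed

lemma card_prime_factors_le:
  assumes "0 < m"
  shows "real (card (prime_factors m)) \<le> 2 * ln (real m)"
proof -
  have "real (2 ^ card (prime_factors m)) \<le> real m"
    using two_power_card_prime_factors_le [OF assms] by (simp only: of_nat_le_iff)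
  then have "ln (2 ^ card (prime_factors m)) \<le> ln (real m)"
    using assms by (subst ln_le_cancel_iff) auto
  then have "real (card (prime_factors m)) * ln 2 \<le> ln (real m)" by (simp add: ln_realpow)
  moreover have "real (card (prime_factors m)) * (1 / 2) \<le> real (card (prime_factors m)) * ln 2"
    using ln2_ge_two_thirds by (intro mult_left_mono) auto
  ultimately show ?thesis by simp
qed

section \<open>The finite Euler product for \<zeta>(2)\<close>

lemma sum_inverse_squares_tail:
  assumes "1 \<le> z"
  shows "(\<Sum>n\<in>{z<..N}. 1 / (real n)\<^sup>2) \<le> 1 / real z"
proof (cases "z \<le> N")
  case True
  then have "(\<Sum>n\<in>{z<..N}. 1 / (real n)\<^sup>2) \<le> 1 / real z - 1 / real N"
  proof (induction N rule: dec_induct)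
    case (step N)
    have N: "0 < real N" using step assms by auto
    have "{z<..Suc N} = insert (Suc N) {z<..N}" using step by auto
    moreover have "1 / (real (Suc N))\<^sup>2 \<le> 1 / (real N * real (Suc N))"
      unfolding power2_eq_square using N by (intro divide_left_mono mult_right_mono) auto
    moreover have "1 / (real N * real (Suc N)) = 1 / real N - 1 / real (Suc N)"
      using N by (simp add: field_simps)
    ultimately show ?case using step by simp
  qed auto
  then show ?thesis by (smt (verit) zero_le_divide_1_iff of_nat_0_le_iff)
qed auto

text \<open>Terms of the series for \<zeta>(2) that survive sieving by S. Indexing by n itself, with
  value 0 at n = 0, lets the multiples of p be reindexed by m \<mapsto> p m.\<close>

definition rough_inverse_square :: "nat set \<Rightarrow> nat \<Rightarrow> real" where
  "rough_inverse_square S n = (if n = 0 \<or> (\<exists>p\<in>S. p dvd n) then 0 else 1 / (real n)\<^sup>2)"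

lemma zeta_2_sums: "rough_inverse_square {} sums zeta 2"
proof -
  have "summable (\<lambda>n. inverse (real n ^ 2))"
    by (rule inverse_power_summable) simp
  then have "summable (\<lambda>n. inverse (real (Suc n) ^ 2))"
    by (subst summable_Suc_iff)
  then have "summable (\<lambda>n. 1 / real (Suc n) powr 2)"
    by (simp add: inverse_eq_divide)
  then have "(\<lambda>n. 1 / real (Suc n) powr 2) sums zeta 2"
    unfolding zeta_def by (rule summable_sums)
  then have "(\<lambda>n. rough_inverse_square {} (Suc n)) sums zeta 2"
    by (simp add: rough_inverse_square_def)
  then show ?thesis
    by (subst (asm) sums_Suc_iff) (simp add: rough_inverse_square_def)
qed

text \<open>Euler's sieve: as p is a new prime, p m and m are divisible by the same primes of S, so
  the multiples of p contribute 1/p^2 of the current sum; removing them leaves the factor 1 -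
  1/p^2.\<close>

lemma rough_inverse_square_sums:
  assumes "finite S" "\<And>p. p \<in> S \<Longrightarrow> prime p"
  shows "rough_inverse_square S sums (zeta 2 * (\<Prod>p\<in>S. 1 - 1 / (real p)\<^sup>2))"
  using assms
proof (induction S rule: finite_induct)
  case empty
  then show ?case using zeta_2_sums by simp
next
  case (insert p S)
  define c where "c = zeta 2 * (\<Prod>p\<in>S. 1 - 1 / (real p)\<^sup>2)"
  have IH: "rough_inverse_square S sums c" using insert by (simp add: c_def)
  have p: "prime p" "0 < p" using insert prime_gt_0_nat by auto
  define g where "g n = (if p dvd n then rough_inverse_square S n else 0)" for n
  have "q dvd p * m \<longleftrightarrow> q dvd m" if "q \<in> S" for q m
  proof -
    have "prime q" "q \<noteq> p" using insert that by auto
    then have "\<not> q dvd p" using p primes_dvd_imp_eq by blast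
    then show ?thesis using \<open>prime q\<close> by (auto simp: prime_dvd_mult_iff)
  qed
  then have gp: "g (p * m) = rough_inverse_square S m / (real p)\<^sup>2" for m
    using p by (auto simp: g_def rough_inverse_square_def power_mult_distrib)
  have "(\<lambda>m. g (p * m)) sums (c / (real p)\<^sup>2)"
    unfolding gp by (intro sums_divide IH)
  moreover have "strict_mono (\<lambda>m. p * m)" using p by (auto intro!: strict_monoI)
  ultimately have "g sums (c / (real p)\<^sup>2)"
    by (subst (asm) sums_mono_reindex [where g = "\<lambda>m. p * m" and f = g]) (auto simp: g_def)
  then have "(\<lambda>n. rough_inverse_square S n - g n) sums (c - c / (real p)\<^sup>2)"
    by (intro sums_diff IH)
  moreover have "(\<lambda>n. rough_inverse_square S n - g n) = rough_inverse_square (insert p S)"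
    by (auto simp: g_def rough_inverse_square_def fun_eq_iff)
  moreover have "c - c / (real p)\<^sup>2 = zeta 2 * (\<Prod>p\<in>insert p S. 1 - 1 / (real p)\<^sup>2)"
    using insert by (simp add: c_def algebra_simps)
  ultimately show ?case by simp
qed

text \<open>After sieving by all primes up to z only n = 1 and certain n > z remain, and the tail of
  the inverse squares beyond z is at most 1/z.\<close>

lemma zeta_2_Euler_product:
  assumes z: "1 \<le> z"
  shows "1 \<le> zeta 2 * (\<Prod>p\<in>primes_upto z. 1 - 1 / (real p)\<^sup>2)"
    and "zeta 2 * (\<Prod>p\<in>primes_upto z. 1 - 1 / (real p)\<^sup>2) \<le> 1 + 1 / real z"
proof -
  let ?f = "rough_inverse_square (primes_upto z)"
  have sums: "?f sums (zeta 2 * (\<Prod>p\<in>primes_upto z. 1 - 1 / (real p)\<^sup>2))"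
    by (rule rough_inverse_square_sums) (auto simp: primes_upto_def)
  note sm = sums_summable [OF sums] and eq = sums_unique [OF sums]
  have nn: "0 \<le> ?f n" for n by (simp add: rough_inverse_square_def)
  have f1: "?f 1 = 1" by (auto simp: rough_inverse_square_def primes_upto_def)
  have "sum ?f {1} \<le> suminf ?f" using nn by (intro sum_le_suminf sm) auto
  then show "1 \<le> zeta 2 * (\<Prod>p\<in>primes_upto z. 1 - 1 / (real p)\<^sup>2)"
    by (simp only: eq [symmetric] sum.insert finite.emptyI empty_iff not_False_eq_True sum.empty f1)
  have zero: "?f n = 0" if n: "n \<noteq> 1" "n \<le> z" for n
  proof (cases "n = 0")
    case False
    obtain p where p: "prime p" "p dvd n" using prime_factor_nat [OF n(1)] by blast
    then have "p \<le> z" using dvd_imp_le [OF p(2)] n False by simp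
    then show ?thesis using p by (auto simp: rough_inverse_square_def primes_upto_def)
  qed (simp add: rough_inverse_square_def)
  have "suminf ?f \<le> 1 + 1 / real z"
  proof (rule suminf_le_const [OF sm])
    fix N
    have "sum ?f {..<N} \<le> sum ?f ({..<N} \<union> {1})" using nn by (intro sum_mono2) auto
    also have "\<dots> = sum ?f ({1} \<union> {z<..<N})"
      using z by (intro sum.mono_neutral_right ballI zero) auto
    also have "\<dots> = 1 + sum ?f {z<..<N}"
      using z f1 by (subst sum.union_disjoint) auto
    also have "sum ?f {z<..<N} \<le> sum ?f {z<..N}" using nn by (intro sum_mono2) auto
    also have "\<dots> \<le> (\<Sum>n\<in>{z<..N}. 1 / (real n)\<^sup>2)"
      by (intro sum_mono) (auto simp: rough_inverse_square_def)
    also have "\<dots> \<le> 1 / real z" by (rule sum_inverse_squares_tail [OF z])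
    finally show "sum ?f {..<N} \<le> 1 + 1 / real z" by simp
  qed
  then show "zeta 2 * (\<Prod>p\<in>primes_upto z. 1 - 1 / (real p)\<^sup>2) \<le> 1 + 1 / real z"
    by (simp only: eq)
qed

text \<open>Strictness makes 1 - 1/\<zeta>(2) positive, which gives the upper bound its
  room.\<close>

lemma zeta_2_gt_1: "1 < zeta 2"
proof -
  have "sum (rough_inverse_square {}) {1, 2} \<le> suminf (rough_inverse_square {})"
    by (rule sum_le_suminf [OF sums_summable [OF zeta_2_sums]]) (auto simp: rough_inverse_square_def)
  then show ?thesis
    by (simp add: rough_inverse_square_def flip: sums_unique [OF zeta_2_sums])
qed

section \<open>The mean value of the totient ratio\<close>

lemma multiples_mass_eq:
  "multiples_mass x q = (\<Sum>n\<in>bulk x. of_bool (q dvd nat \<lfloor>x / real n\<rfloor>) / real n)"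
  unfolding multiples_mass_def by (intro sum.mono_neutral_cong_left) auto

text \<open>For fixed z finitely many moduli occur, each dividing [x/n] with density 1 /
  \<open>\<Prod>S\<close>. Summing the coefficients against these densities rebuilds the product of
  1 - 1/p^2; each modulus gets an equal share of \<epsilon>.\<close>

lemma sieved_mass_asymp:
  assumes ep: "0 < \<epsilon>"
  shows "\<forall>\<^sub>F x in at_top. \<bar>(\<Sum>n\<in>bulk x. sieved_ratio z (nat \<lfloor>x / real n\<rfloor>) / real n)
      - (\<Prod>p\<in>primes_upto z. 1 - 1 / (real p)\<^sup>2) * bulk_mass x\<bar> \<le> \<epsilon> * bulk_mass x"
proof -
  define P where "P = Pow (primes_upto z)"
  have P: "finite P" "P \<noteq> {}" by (auto simp: P_def)
  define c where "c S = (\<Prod>p\<in>S. - (1 / real p))" for S :: "nat set"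
  have fS: "finite S" and pS: "\<And>p. p \<in> S \<Longrightarrow> 0 < p" if "S \<in> P" for S
    using that finite_subset [OF _ finite_primes_upto]
    by (auto simp: P_def primes_upto_def intro: prime_gt_0_nat)
  have c1: "\<bar>c S\<bar> \<le> 1" if "S \<in> P" for S
    unfolding c_def abs_prod using pS [OF that] by (intro prod_le_1) (auto simp: Suc_le_eq)
  have "(\<Prod>p\<in>primes_upto z. 1 - 1 / (real p)\<^sup>2) = (\<Prod>p\<in>primes_upto z. - (1 / (real p)\<^sup>2) + 1)"
    by simp
  also have "\<dots> = (\<Sum>S\<in>P. \<Prod>p\<in>S. - (1 / (real p)\<^sup>2))"
    unfolding prod_add [OF finite_primes_upto] P_def by simp
  also have "\<dots> = (\<Sum>S\<in>P. c S / real (\<Prod>S))"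
    by (intro sum.cong refl) (simp add: c_def power2_eq_square flip: prod_dividef)
  finally have prod_eq: "(\<Prod>p\<in>primes_upto z. 1 - 1 / (real p)\<^sup>2) = (\<Sum>S\<in>P. c S / real (\<Prod>S))" .
  have "\<forall>\<^sub>F x in at_top. \<forall>S\<in>P. \<bar>multiples_mass x (\<Prod>S) - bulk_mass x / real (\<Prod>S)\<bar>
      \<le> \<epsilon> / real (card P) * bulk_mass x"
  proof (intro eventually_ball_finite P ballI multiples_mass_asymp)
    fix S assume "S \<in> P"
    then show "1 \<le> \<Prod>S" using fS pS by (simp add: Suc_le_eq prod_pos)
  qed (use ep P in \<open>auto simp: card_gt_0_iff\<close>)
  then show ?thesis
  proof eventually_elim
    case (elim x)
    have "(\<Sum>n\<in>bulk x. sieved_ratio z (nat \<lfloor>x / real n\<rfloor>) / real n)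
        = (\<Sum>n\<in>bulk x. \<Sum>S\<in>P. c S * (of_bool (\<Prod>S dvd nat \<lfloor>x / real n\<rfloor>) / real n))"
      by (simp only: sieved_ratio_expand P_def c_def sum_divide_distrib times_divide_eq_right)
    also have "\<dots> = (\<Sum>S\<in>P. \<Sum>n\<in>bulk x. c S * (of_bool (\<Prod>S dvd nat \<lfloor>x / real n\<rfloor>) / real n))"
      by (rule sum.swap)
    also have "\<dots> = (\<Sum>S\<in>P. c S * multiples_mass x (\<Prod>S))"
      by (simp only: multiples_mass_eq sum_distrib_left)
    finally have "(\<Sum>n\<in>bulk x. sieved_ratio z (nat \<lfloor>x / real n\<rfloor>) / real n)
        - (\<Prod>p\<in>primes_upto z. 1 - 1 / (real p)\<^sup>2) * bulk_mass x
        = (\<Sum>S\<in>P. c S * (multiples_mass x (\<Prod>S) - bulk_mass x / real (\<Prod>S)))"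
      by (simp add: prod_eq right_diff_distrib sum_subtractf sum_distrib_right)
    also have "\<bar>\<dots>\<bar> \<le> (\<Sum>S\<in>P. \<bar>c S * (multiples_mass x (\<Prod>S) - bulk_mass x / real (\<Prod>S))\<bar>)"
      by (rule sum_abs)
    also have "\<dots> \<le> (\<Sum>S\<in>P. 1 * (\<epsilon> / real (card P) * bulk_mass x))"
      unfolding abs_mult using c1 elim by (intro sum_mono mult_mono) auto
    also have "\<dots> = \<epsilon> * bulk_mass x" using P by simp
    finally show ?case .
  qed
qed

text \<open>Up to (ln x)^2 the uniform bound of order 1/p gives 6 times the sum of 1/p^2 over p > z.
  Larger primes number at most 2 ln x for each n and contribute at most 2 / ln x. The seventh 1/z
  absorbs both lower order errors.\<close>

lemma large_prime_factors_mass: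
  assumes z: "1 \<le> z"
  shows "\<forall>\<^sub>F x in at_top. (\<Sum>n\<in>bulk x. (\<Sum>p\<in>{p\<in>prime_factors (nat \<lfloor>x / real n\<rfloor>). z < p}. 1 / real p) / real n)
      \<le> 7 / real z * bulk_mass x"
proof -
  have "\<forall>\<^sub>F x::real in at_top. 2 / ln x \<le> 1 / (2 * real z)" using z by real_asymp
  moreover have "\<forall>\<^sub>F x::real in at_top. ln x ^ 2 / ln x ^ 10 \<le> 1 / (2 * real z)" using z by real_asymp
  moreover have "\<forall>\<^sub>F x::real in at_top. 1 \<le> 7 / 10 * ln x - 1" by real_asymp
  ultimately show ?thesis
    using multiples_mass_uniform bulk_mass_ge eventually_gt_at_top [of 1]
  proof eventually_elim
    case (elim x)
    have x: "1 < x" "0 < ln x" "1 \<le> bulk_mass x" using elim by auto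
    define Y where "Y = nat \<lfloor>ln x ^ 2\<rfloor>"
    have Y: "real Y \<le> ln x ^ 2" "ln x ^ 2 < real Y + 1"
      unfolding Y_def using x by (auto simp: of_nat_nat)
    have le: "(\<Sum>p\<in>{p\<in>prime_factors (nat \<lfloor>x / real n\<rfloor>). z < p}. 1 / real p)
        \<le> (\<Sum>p\<in>{z<..Y}. of_bool (p dvd nat \<lfloor>x / real n\<rfloor>) / real p) + 2 / ln x" if n: "n \<in> bulk x" for n
    proof -
      define m where "m = nat \<lfloor>x / real n\<rfloor>"
      have n1: "1 \<le> n" "real n \<le> x" using bulk_memberD [of x n] n x by auto
      then have "1 \<le> x / real n" by simp
      moreover have "x / real n \<le> x / 1" using n1 x by (intro divide_left_mono) auto
      ultimately have m: "1 \<le> m" "real m \<le> x" unfolding m_def by linarith+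
      \<comment> \<open>Up to \<open>Y\<close> primality is dropped, which only enlarges the
        sum.\<close>
      have "(\<Sum>p\<in>{p\<in>prime_factors m. z < p}. 1 / real p)
          \<le> (\<Sum>p\<in>{p\<in>{z<..Y}. p dvd m} \<union> {p\<in>prime_factors m. Y < p}. 1 / real p)"
        by (intro sum_mono2) auto
      also have "\<dots> = (\<Sum>p\<in>{p\<in>{z<..Y}. p dvd m}. 1 / real p) + (\<Sum>p\<in>{p\<in>prime_factors m. Y < p}. 1 / real p)"
        by (intro sum.union_disjoint) auto
      also have "(\<Sum>p\<in>{p\<in>{z<..Y}. p dvd m}. 1 / real p) = (\<Sum>p\<in>{z<..Y}. of_bool (p dvd m) / real p)"
        by (intro sum.mono_neutral_cong_left) auto
      also have "(\<Sum>p\<in>{p\<in>prime_factors m. Y < p}. 1 / real p) \<le> (\<Sum>p\<in>{p\<in>prime_factors m. Y < p}. 1 / ln x ^ 2)"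
      proof (intro sum_mono divide_left_mono)
        fix p assume "p \<in> {p\<in>prime_factors m. Y < p}"
        then show "ln x ^ 2 \<le> real p" using Y by auto
        then show "0 < real p * ln x ^ 2" using x by (smt (verit) zero_less_mult_iff zero_less_power)
      qed auto
      also have "\<dots> \<le> (\<Sum>p\<in>prime_factors m. 1 / ln x ^ 2)"
        by (intro sum_mono2) auto
      also have "\<dots> = real (card (prime_factors m)) / ln x ^ 2" by simp
      also have "\<dots> \<le> (2 * ln x) / ln x ^ 2"
      proof (intro divide_right_mono)
        have "ln (real m) \<le> ln x" using m x by (subst ln_le_cancel_iff) auto
        then show "real (card (prime_factors m)) \<le> 2 * ln x"
          using card_prime_factors_le [of m] m by linarith
      qed auto
      also have "\<dots> = 2 / ln x" using x by (simp add: power2_eq_square)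
      finally show ?thesis by (simp add: m_def)
    qed
    have "(\<Sum>n\<in>bulk x. (\<Sum>p\<in>{p\<in>prime_factors (nat \<lfloor>x / real n\<rfloor>). z < p}. 1 / real p) / real n)
        \<le> (\<Sum>n\<in>bulk x. ((\<Sum>p\<in>{z<..Y}. of_bool (p dvd nat \<lfloor>x / real n\<rfloor>) / real p) + 2 / ln x) / real n)"
      by (intro sum_mono divide_right_mono le) auto
    also have "\<dots> = (\<Sum>n\<in>bulk x. \<Sum>p\<in>{z<..Y}. of_bool (p dvd nat \<lfloor>x / real n\<rfloor>) / real n / real p)
        + 2 / ln x * bulk_mass x"
      by (simp add: add_divide_distrib sum.distrib sum_divide_distrib bulk_mass_def sum_distrib_left mult.commute)
    also have "(\<Sum>n\<in>bulk x. \<Sum>p\<in>{z<..Y}. of_bool (p dvd nat \<lfloor>x / real n\<rfloor>) / real n / real p)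
        = (\<Sum>p\<in>{z<..Y}. multiples_mass x p / real p)"
      unfolding multiples_mass_eq sum_divide_distrib by (rule sum.swap)
    also have "\<dots> \<le> (\<Sum>p\<in>{z<..Y}. 6 * bulk_mass x * (1 / (real p)\<^sup>2) + 1 / ln x ^ 10)"
    proof (intro sum_mono)
      fix p assume p: "p \<in> {z<..Y}"
      then have p2: "2 \<le> p \<and> real p \<le> ln x ^ 2" using z Y by auto
      have "multiples_mass x p / real p \<le> (6 * bulk_mass x / real p + 1 / ln x ^ 10) / real p"
        using elim(4) p2 by (intro divide_right_mono) auto
      also have "\<dots> = 6 * bulk_mass x * (1 / (real p)\<^sup>2) + (1 / ln x ^ 10) / real p"
        by (simp add: add_divide_distrib power2_eq_square)
      also have "(1 / ln x ^ 10) / real p \<le> (1 / ln x ^ 10) / 1"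
        using p2 x by (intro divide_left_mono) auto
      finally show "multiples_mass x p / real p \<le> 6 * bulk_mass x * (1 / (real p)\<^sup>2) + 1 / ln x ^ 10" by simp
    qed
    also have "\<dots> = 6 * bulk_mass x * (\<Sum>p\<in>{z<..Y}. 1 / (real p)\<^sup>2) + real (Y - z) * (1 / ln x ^ 10)"
      by (simp add: sum.distrib sum_distrib_left)
    also have "\<dots> \<le> 6 * bulk_mass x * (1 / real z) + ln x ^ 2 * (1 / ln x ^ 10)"
      using x Y by (intro add_mono mult_left_mono mult_right_mono sum_inverse_squares_tail z) auto
    finally have "(\<Sum>n\<in>bulk x. (\<Sum>p\<in>{p\<in>prime_factors (nat \<lfloor>x / real n\<rfloor>). z < p}. 1 / real p) / real n)
        \<le> 6 * bulk_mass x * (1 / real z) + ln x ^ 2 * (1 / ln x ^ 10) + 2 / ln x * bulk_mass x" by simp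
    also have "\<dots> \<le> 6 * bulk_mass x * (1 / real z) + 1 / (2 * real z) * bulk_mass x + 1 / (2 * real z) * bulk_mass x"
    proof (intro add_mono order_refl mult_right_mono elim)
      have "ln x ^ 2 * (1 / ln x ^ 10) \<le> 1 / (2 * real z) * 1" using elim by simp
      also have "\<dots> \<le> 1 / (2 * real z) * bulk_mass x" using x by (intro mult_left_mono) auto
      finally show "ln x ^ 2 * (1 / ln x ^ 10) \<le> 1 / (2 * real z) * bulk_mass x" .
    qed (use x in auto)
    also have "\<dots> = 7 / real z * bulk_mass x" using z by (simp add: field_simps)
    finally show ?case .
  qed
qed

section \<open>From the mean value on the bulk to the totient sum\<close>

definition floor_totient_sum :: "real \<Rightarrow> real" where
  "floor_totient_sum x = (\<Sum>n | 0 < n \<and> real n \<le> x. real (totient (nat \<lfloor>x / real n\<rfloor>)))"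

lemma index_set_eq: "0 \<le> x \<Longrightarrow> {n. 0 < n \<and> real n \<le> x} = {1..<Suc (nat \<lfloor>x\<rfloor>)}"
  by (auto simp: le_nat_floor less_Suc_eq_le Suc_le_eq) linarith

text \<open>Terms outside the bulk are nonnegative. On it, replacing x/n by [x/n] costs at most 1
  per term, and there are at most x terms; hence the loss x.\<close>

lemma floor_totient_sum_lower:
  assumes x: "1 \<le> x"
  shows "x * ((\<Sum>n\<in>bulk x. sieved_ratio z (nat \<lfloor>x / real n\<rfloor>) / real n)
     - (\<Sum>n\<in>bulk x. (\<Sum>p\<in>{p\<in>prime_factors (nat \<lfloor>x / real n\<rfloor>). z < p}. 1 / real p) / real n)) - x
     \<le> floor_totient_sum x"
proof -
  let ?m = "\<lambda>n. nat \<lfloor>x / real n\<rfloor>"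
  let ?s = "\<lambda>n. sieved_ratio z (?m n)" and ?T = "\<lambda>n. \<Sum>p\<in>{p\<in>prime_factors (?m n). z < p}. 1 / real p"
  have sub: "bulk x \<subseteq> {n. 0 < n \<and> real n \<le> x}" using bulk_memberD [OF x] by (auto simp: Suc_le_eq)
  have fin: "finite {n. 0 < n \<and> real n \<le> x}" using x by (simp add: index_set_eq)
  have "card (bulk x) \<le> nat \<lfloor>x\<rfloor>"
    using card_mono [OF fin sub] x by (simp add: index_set_eq)
  then have card: "real (card (bulk x)) \<le> x" using x by linarith
  have pointwise: "x * (?s n / real n - ?T n / real n) - 1 \<le> real (totient (?m n))" if "n \<in> bulk x" for n
  proof -
    have n: "1 \<le> n" "real n \<le> x" using bulk_memberD [OF x that] by auto
    then have x1: "1 \<le> x / real n" by simp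
    then have m: "1 \<le> ?m n" "x / real n \<le> real (?m n) + 1" by linarith+
    have m0: "0 < real (?m n)" using m(1) by linarith
    have "real (?m n) * (?s n - ?T n) \<le> real (totient (?m n))"
      using m0 by (intro totient_sieved_bounds) (simp only: of_nat_0_less_iff)
    then have le: "?s n - ?T n \<le> real (totient (?m n)) / real (?m n)"
      using m0 by (simp only: pos_le_divide_eq mult.commute)
    have le1: "real (totient (?m n)) / real (?m n) \<le> 1"
      using m0 totient_le [of "?m n"] by (simp only: divide_le_eq_1_pos of_nat_le_iff)
    have "x * (?s n / real n - ?T n / real n) = x / real n * (?s n - ?T n)"
      by (simp add: diff_divide_distrib right_diff_distrib)
    also have "\<dots> \<le> x / real n * (real (totient (?m n)) / real (?m n))"
      using le x by (intro mult_left_mono) auto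
    also have "\<dots> \<le> (real (?m n) + 1) * (real (totient (?m n)) / real (?m n))"
      using m by (intro mult_right_mono) auto
    also have "\<dots> = real (totient (?m n)) + real (totient (?m n)) / real (?m n)"
    proof -
      have "(c + 1) * (t / c) = t + t / c" if "0 < c" for c t :: real
        using that by (simp add: field_simps)
      from this [OF m0] show ?thesis .
    qed
    finally show ?thesis using le1 by linarith
  qed
  have "x * ((\<Sum>n\<in>bulk x. ?s n / real n) - (\<Sum>n\<in>bulk x. ?T n / real n)) - real (card (bulk x))
      = (\<Sum>n\<in>bulk x. x * (?s n / real n - ?T n / real n) - 1)"
    by (simp add: sum_subtractf sum_distrib_left right_diff_distrib)
  also have "\<dots> \<le> (\<Sum>n\<in>bulk x. real (totient (?m n)))" by (intro sum_mono pointwise)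
  also have "\<dots> \<le> floor_totient_sum x"
    unfolding floor_totient_sum_def using fin sub by (intro sum_mono2) auto
  finally show ?thesis using card by linarith
qed

text \<open>Off the bulk the totient is bounded by x/n, whose sum is x times the harmonic sum minus
  the bulk mass; the harmonic sum is at most 2 + ln x.\<close>

lemma floor_totient_sum_upper:
  assumes x: "1 \<le> x"
  shows "floor_totient_sum x
     \<le> x * (2 + ln x - bulk_mass x + (\<Sum>n\<in>bulk x. sieved_ratio z (nat \<lfloor>x / real n\<rfloor>) / real n))"
proof -
  let ?m = "\<lambda>n. nat \<lfloor>x / real n\<rfloor>" and ?I = "{n. 0 < n \<and> real n \<le> x}"
  have sub: "bulk x \<subseteq> ?I" using bulk_memberD [OF x] by (auto simp: Suc_le_eq)
  have fin: "finite ?I" using x by (simp add: index_set_eq)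
  have m: "1 \<le> ?m n" "real (?m n) \<le> x / real n" if "n \<in> ?I" for n
  proof -
    have "1 \<le> x / real n" using that by simp
    then show "1 \<le> ?m n" "real (?m n) \<le> x / real n" by linarith+
  qed
  have "floor_totient_sum x = (\<Sum>n\<in>?I - bulk x. real (totient (?m n))) + (\<Sum>n\<in>bulk x. real (totient (?m n)))"
    unfolding floor_totient_sum_def by (rule sum.subset_diff [OF sub fin])
  also have "\<dots> \<le> (\<Sum>n\<in>?I - bulk x. x * (1 / real n)) + (\<Sum>n\<in>bulk x. x * (sieved_ratio z (?m n) / real n))"
  proof (intro add_mono sum_mono)
    fix n assume "n \<in> ?I - bulk x"
    then have "real (?m n) \<le> x / real n" by (intro m) auto
    then show "real (totient (?m n)) \<le> x * (1 / real n)"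
      using totient_le [of "?m n"] by simp
  next
    fix n assume "n \<in> bulk x"
    then have n: "n \<in> ?I" using sub by auto
    have "real (totient (?m n)) \<le> real (?m n) * sieved_ratio z (?m n)"
      using m [OF n] by (intro totient_sieved_bounds) auto
    also have "\<dots> \<le> x / real n * sieved_ratio z (?m n)"
      using m [OF n] by (intro mult_right_mono)
        (auto simp: sieved_ratio_def primes_upto_def intro!: prod_nonneg dest: prime_gt_0_nat)
    finally show "real (totient (?m n)) \<le> x * (sieved_ratio z (?m n) / real n)" by simp
  qed
  also have "\<dots> = x * ((\<Sum>n\<in>?I - bulk x. 1 / real n) + (\<Sum>n\<in>bulk x. sieved_ratio z (?m n) / real n))"
    by (simp only: distrib_left sum_distrib_left)
  also have "\<dots> \<le> x * (2 + ln x - bulk_mass x + (\<Sum>n\<in>bulk x. sieved_ratio z (?m n) / real n))"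
  proof (intro mult_left_mono add_right_mono)
    have "(\<Sum>n\<in>?I. 1 / real n) = (\<Sum>n\<in>?I - bulk x. 1 / real n) + bulk_mass x"
      unfolding bulk_mass_def by (rule sum.subset_diff [OF sub fin])
    moreover have "(\<Sum>n\<in>?I. 1 / real n) \<le> 1 + ln (real (Suc (nat \<lfloor>x\<rfloor>))) - ln (real 1)"
      using x by (simp only: index_set_eq [of x] order_trans [OF zero_le_one x]) (intro sum_inverse_bounds; simp)
    moreover have "ln (real (Suc (nat \<lfloor>x\<rfloor>))) \<le> 1 + ln x"
    proof -
      have "real (Suc (nat \<lfloor>x\<rfloor>)) \<le> 2 * x" using x by linarith
      then have "ln (real (Suc (nat \<lfloor>x\<rfloor>))) \<le> ln (2 * x)"
        using x by (subst ln_le_cancel_iff) (auto simp del: of_nat_Suc)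
      also have "\<dots> = ln 2 + ln x" using x by (simp add: ln_mult)
      finally show ?thesis using ln_2_less_1 by linarith
    qed
    ultimately show "(\<Sum>n\<in>?I - bulk x. 1 / real n) \<le> 2 + ln x - bulk_mass x" by simp
  qed (use x in auto)
  finally show ?thesis .
qed

theorem theorem1p2:
  shows "\<exists>E\<^sub>1 E\<^sub>2 :: real \<Rightarrow> real.
    E\<^sub>1 \<in> O[at_top](\<lambda>x. x * ln (ln x)) \<and>
    E\<^sub>2 \<in> O[at_top](\<lambda>x. x * ln (ln x)) \<and>
    (\<forall>\<^sub>F x in at_top.
      285 / 416 * (1 / zeta 2) * (x * ln x) + E\<^sub>1 x
        \<le> (\<Sum>n | 0 < n \<and> real n \<le> x. real (totient (nat \<lfloor>x / real n\<rfloor>))) \<and>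
      (\<Sum>n | 0 < n \<and> real n \<le> x. real (totient (nat \<lfloor>x / real n\<rfloor>)))
        \<le> (285 / 416 * (1 / zeta 2) + 131 / 416) * (x * ln x) + E\<^sub>2 x)"
proof -
  define a where "a = 1 / zeta 2"
  have a: "0 < a" "a < 1" using zeta_2_gt_1 by (auto simp: a_def)
  \<comment> \<open>Two errors of size \<epsilon> then cost at most 2 percent of a in the lower
    bound and of 1 - a in the upper one.\<close>
  define \<epsilon> where "\<epsilon> = min a (1 - a) / 100"
  have ep: "0 < \<epsilon>" "\<epsilon> \<le> a / 100" "\<epsilon> \<le> (1 - a) / 100" using a by (auto simp: \<epsilon>_def)
  obtain z :: nat where "7 / \<epsilon> < real z" using reals_Archimedean2 by blast
  moreover from this have "0 < z" using ep by (cases z) (auto simp: divide_less_0_iff)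
  ultimately have z: "1 \<le> z" "7 / real z \<le> \<epsilon>" using ep by (auto simp: field_simps)
  define P where "P = (\<Prod>p\<in>primes_upto z. 1 - 1 / (real p)\<^sup>2)"
  have P: "a \<le> P" "P \<le> a + \<epsilon>"
  proof -
    have z2: "0 < zeta 2" using zeta_2_gt_1 by linarith
    show "a \<le> P" using zeta_2_Euler_product(1) [OF z(1)] z2 by (simp add: a_def P_def field_simps)
    have "P \<le> (1 + 1 / real z) / zeta 2"
      using zeta_2_Euler_product(2) [OF z(1)] z2 by (simp add: P_def pos_le_divide_eq mult.commute)
    also have "\<dots> = a + a * (1 / real z)" by (simp add: a_def add_divide_distrib)
    also have "a * (1 / real z) \<le> 1 * (7 / real z)" using a by (intro mult_mono divide_right_mono) auto
    finally show "P \<le> a + \<epsilon>" using z(2) by simp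
  qed
  \<comment> \<open>686/1000 is 98/100 of the density 7/10 and still exceeds 285/416 = 0.6850..., so
    the surplus multiple of ln x absorbs the constants.\<close>
  have "\<forall>\<^sub>F x::real in at_top. 1 + 98/100 * a \<le> (686/1000 - 285/416) * a * ln x"
    using a by real_asymp
  moreover have "\<forall>\<^sub>F x::real in at_top. 2 + 98/100 * (1 - a) \<le> (686/1000 - 285/416) * (1 - a) * ln x"
    using a by real_asymp
  ultimately have "\<forall>\<^sub>F x in at_top.
      285 / 416 * a * (x * ln x) \<le> floor_totient_sum x \<and>
      floor_totient_sum x \<le> (285 / 416 * a + 131 / 416) * (x * ln x)"
    using sieved_mass_asymp [OF ep(1), of z] large_prime_factors_mass [OF z(1)] bulk_mass_ge
      eventually_ge_at_top [of 1]
  proof eventually_elim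
    case (elim x)
    define S where "S = (\<Sum>n\<in>bulk x. sieved_ratio z (nat \<lfloor>x / real n\<rfloor>) / real n)"
    define T where "T = (\<Sum>n\<in>bulk x. (\<Sum>p\<in>{p\<in>prime_factors (nat \<lfloor>x / real n\<rfloor>). z < p}. 1 / real p) / real n)"
    have W0: "0 \<le> bulk_mass x" by (rule bulk_mass_nonneg)
    have S_bounds: "P * bulk_mass x - \<epsilon> * bulk_mass x \<le> S" "S \<le> P * bulk_mass x + \<epsilon> * bulk_mass x"
      using elim(3) by (auto simp: P_def S_def abs_le_iff)
    have "T \<le> \<epsilon> * bulk_mass x"
      using elim(4) mult_right_mono [OF z(2) W0] unfolding T_def by (rule order_trans)
    moreover have "(98/100 * a) * bulk_mass x \<le> (P - \<epsilon> - \<epsilon>) * bulk_mass x"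
      using P ep W0 by (intro mult_right_mono) auto
    moreover have "(98/100 * a) * (7 / 10 * ln x - 1) \<le> (98/100 * a) * bulk_mass x"
      using a elim by (intro mult_left_mono) auto
    ultimately have "285/416 * a * ln x \<le> S - T - 1"
      using S_bounds elim(1) by (simp add: algebra_simps)
    from mult_left_mono [OF this, of x] floor_totient_sum_lower [of x z, folded S_def T_def] elim(6)
    have lower: "285 / 416 * a * (x * ln x) \<le> floor_totient_sum x"
      by (simp add: algebra_simps)
    define b where "b = 1 - a"
    have "(98/100 * b) * bulk_mass x \<le> (1 - P - \<epsilon>) * bulk_mass x"
      using P ep W0 by (intro mult_right_mono) (auto simp: b_def)
    moreover have "(98/100 * b) * (7 / 10 * ln x - 1) \<le> (98/100 * b) * bulk_mass x"
      using a elim by (intro mult_left_mono) (auto simp: b_def)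
    ultimately have "2 + ln x - bulk_mass x + S \<le> (1 - 285 / 416 * b) * ln x"
      using S_bounds elim(2) unfolding b_def [symmetric] by (simp add: algebra_simps)
    \<comment> \<open>The trivial bound on the remaining proportion accounts for 131/416 = 1 -
      285/416.\<close>
    also have "1 - 285 / 416 * b = 285 / 416 * a + 131 / 416"
      by (simp add: b_def field_simps)
    finally have "2 + ln x - bulk_mass x + S \<le> (285 / 416 * a + 131 / 416) * ln x" .
    from mult_left_mono [OF this, of x] floor_totient_sum_upper [of x z, folded S_def] elim(6)
    have upper: "floor_totient_sum x \<le> (285 / 416 * a + 131 / 416) * (x * ln x)"
      by (simp add: algebra_simps)
    show ?case using lower upper by blast
  qed
  then have "\<forall>\<^sub>F x in at_top.
      285 / 416 * (1 / zeta 2) * (x * ln x) + (\<lambda>_. 0) x \<le> floor_totient_sum x \<and>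
      floor_totient_sum x \<le> (285 / 416 * (1 / zeta 2) + 131 / 416) * (x * ln x) + (\<lambda>_. 0) x"
    by (simp add: a_def)
  then show ?thesis
    \<comment> \<open>The surplus density has absorbed all lower order terms, so the zero function
      serves as both error terms.\<close>
    unfolding floor_totient_sum_def
    by (intro exI [of _ "\<lambda>_. 0"] conjI) auto
qed

end
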